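(* Let $\lambda\ge 0$, $\eta$ and $\alpha_1,\dots,\alpha_\lambda$ be integers with $0<\alpha_1<\cdots<\alpha_\lambda<\eta$ and $\alpha_i=\eta-\alpha_{\lambda+1-i}$ for $1\le i\le\lambda$, and let $k,r$ be integers with $k\ge r\ge\lambda\ge0$ and $k>\lambda$. There is a bijection $\Phi:\mathcal{D}_\eta\times\mathcal{B}_0(\alpha_1,\ldots,\alpha_\lambda;\eta,k,r)\to\overline{\mathcal{B}}_1(\alpha_1,\ldots,\alpha_\lambda;\eta,k,r)$ such that $|\Phi(\zeta,\mu)|=|\zeta|+|\mu|$ for all $(\zeta,\mu)$.
   Context: Overpartitions: the first occurrence of a part size may be overlined. Parts are ordered $1<\bar1<2<\bar2<\cdots$; $\pi=(\pi_1,\dots,\pi_s)$ with $\pi_1\ge\cdots\ge\pi_s$ in this order; inequalities between parts are in this order, and $x\pm\eta$ is the part of size $|x|\pm\eta$ overlined iff $x$ is. $[x/\eta]=\lfloor|x|/\eta\rfloor$; $\overline{V}_\pi(N)$ is the number of overlined parts of $\pi$ that are $\le N$; $|\pi|$ is the sum of the part sizes. For $j\in\{0,1\}$, $\overline{\mathcal{B}}_j(\alpha_1,\ldots,\alpha_\lambda;\eta,k,r)$ is the set of overpartitions $\pi=(\pi_1,\dots,\pi_s)$ (of any size) such that: (1) every part has size $\equiv 0,\alpha_1,\ldots,\alpha_\lambda\pmod\eta$; (2) only parts whose size is a multiple of $\eta$ may be non-overlined; (3) $\pi_i\ge\pi_{i+k-1}+\eta$ whenever $i+k-1\le s$, with strict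 inequality if $\pi_i$ is non-overlined; (4) at most $r-1$ parts satisfy $\pi_i\le\eta$; (5) whenever $i+k-2\le s$ and $\pi_i\le\pi_{i+k-2}+\eta$ with strict inequality if $\pi_i$ is overlined, then $[\pi_i/\eta]+\cdots+[\pi_{i+k-2}/\eta]\equiv r-1+\overline{V}_\pi(\pi_i)\pmod{2-j}$. The set $\mathcal{B}_j(\alpha_1,\ldots,\alpha_\lambda;\eta,k,r)$ consists of those $\pi\in\overline{\mathcal{B}}_j(\alpha_1,\ldots,\alpha_\lambda;\eta,k,r)$ having no overlined part whose size is a multiple of $\eta$ (equivalently, after removing overlines, Bressoud's partitions counted by $B_j(\alpha_1,\ldots,\alpha_\lambda;\eta,k,r;n)$). $\mathcal{D}_\eta$ is the set of partitions (including the empty one) into distinct parts each divisible by $\eta$.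
   Formalization: The case k = r = 1 (hence λ = 0) is excluded: there condition (3) makes B_0 and \overline{B}_1 both consist of the empty overpartition only, while D_η is infinite, so no bijection exists. *)

theory Defs
  imports "HOL-Number_Theory.Cong"
begin

datatype part = Part (part_size: nat) (overlined: bool)

text \<open>The order \<open>1 < \<bar>1 < 2 < \<bar>2 < \<dots>\<close> is lexicographic, with
  \<open>False < True\<close> on the overline flag.\<close>

instantiation part :: linorder
begin

definition less_eq_part :: "part \<Rightarrow> part \<Rightarrow> bool" where
  "x \<le> y \<longleftrightarrow> part_size x < part_size y \<or>
     (part_size x = part_size y \<and> (overlined x \<longrightarrow> overlined y))"

definition less_part :: "part \<Rightarrow> part \<Rightarrow> bool" where
  "x < y \<longleftrightarrow> part_size x < part_size y \<or>
     (part_size x = part_size y \<and> \<not> overlined x \<and> overlined y)"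

instance
  by standard (auto simp: less_eq_part_def less_part_def intro: part.expand)

end

definition shift :: "nat \<Rightarrow> part \<Rightarrow> part" where
  "shift \<eta> x = Part (part_size x + \<eta>) (overlined x)"

text \<open>In a decreasing list an overlined part precedes the non-overlined parts of its size, so
  ``only the first occurrence may be overlined'' says that no overlined part is repeated.\<close>

definition overpartition :: "part list \<Rightarrow> bool" where
  "overpartition \<pi> \<longleftrightarrow> sorted_wrt (\<ge>) \<pi> \<and> (\<forall>x\<in>set \<pi>. 0 < part_size x) \<and>
     (\<forall>t. count_list \<pi> (Part t True) \<le> 1)"

definition weight :: "part list \<Rightarrow> nat" where
  "weight \<pi> = sum_list (map part_size \<pi>)"

definition overlined_upto :: "part list \<Rightarrow> part \<Rightarrow> nat" where
  "overlined_upto \<pi> x = length (filter (\<lambda>y. overlined y \<and> y \<le> x) \<pi>)"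

text \<open>The moduli \<open>\<alpha>\<^sub>1, \<dots>, \<alpha>\<^sub>m\<close> are \<open>\<alpha> 1, \<dots>, \<alpha> m\<close>; list positions start at 0. The bound
  \<open>r - 1\<close> is taken in the integers, so it is negative for \<open>r = 0\<close>. The truncated \<open>k - 2\<close>
  only matters for \<open>k = 1\<close>, where the distance condition already forces the list to be empty
  when \<open>0 < \<eta>\<close>.\<close>

definition B_bar :: "nat \<Rightarrow> nat \<Rightarrow> (nat \<Rightarrow> nat) \<Rightarrow> nat \<Rightarrow> nat \<Rightarrow> nat \<Rightarrow> part list set" where
  "B_bar j m \<alpha> \<eta> k r = {\<pi>. overpartition \<pi> \<and>
     (\<forall>x\<in>set \<pi>. [part_size x = 0] (mod \<eta>) \<or> (\<exists>i\<in>{1..m}. [part_size x = \<alpha> i] (mod \<eta>))) \<and>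
     (\<forall>x\<in>set \<pi>. \<not> overlined x \<longrightarrow> \<eta> dvd part_size x) \<and>
     (\<forall>i. i + (k - 1) < length \<pi> \<longrightarrow>
        \<pi> ! i \<ge> shift \<eta> (\<pi> ! (i + (k - 1))) \<and>
        (\<not> overlined (\<pi> ! i) \<longrightarrow> \<pi> ! i > shift \<eta> (\<pi> ! (i + (k - 1))))) \<and>
     int (length (filter (\<lambda>x. x \<le> Part \<eta> False) \<pi>)) \<le> int r - 1 \<and>
     (\<forall>i. i + (k - 2) < length \<pi> \<and>
        \<pi> ! i \<le> shift \<eta> (\<pi> ! (i + (k - 2))) \<and>
        (overlined (\<pi> ! i) \<longrightarrow> \<pi> ! i < shift \<eta> (\<pi> ! (i + (k - 2)))) \<longrightarrow>
        [(\<Sum>h = i..i + (k - 2). int (part_size (\<pi> ! h) div \<eta>)) =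
           int r - 1 + int (overlined_upto \<pi> (\<pi> ! i))] (mod (2 - int j)))}"

definition B :: "nat \<Rightarrow> nat \<Rightarrow> (nat \<Rightarrow> nat) \<Rightarrow> nat \<Rightarrow> nat \<Rightarrow> nat \<Rightarrow> part list set" where
  "B j m \<alpha> \<eta> k r =
     {\<pi> \<in> B_bar j m \<alpha> \<eta> k r. \<forall>x\<in>set \<pi>. overlined x \<longrightarrow> \<not> \<eta> dvd part_size x}"

definition distinct_multiples :: "nat \<Rightarrow> nat list set" where
  "distinct_multiples \<eta> = {\<zeta>. sorted_wrt (>) \<zeta> \<and> (\<forall>x\<in>set \<zeta>. 0 < x \<and> \<eta> dvd x)}"

end

theory Submission
  imports Defs
begin

text \<open>Write a part as twice its size, plus one if it is overlined, and put \<open>H = 2\<eta>\<close>, \<open>w = k - 1\<close>.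
  Call \<open>w\<close> consecutive parts within distance \<open>\<eta>\<close> a tight window; condition (5) prescribes the
  parity of each of them. Advancing a window replaces its smallest part \<open>x\<close> by \<open>x + \<eta>\<close>,
  which raises the weight by \<open>\<eta>\<close>, keeps the window tight and flips its parity. Choosing disjoint
  windows greedily from the top, one may advance the topmost \<open>p\<close> of them; this is undone by
  retreating windows chosen greedily from the bottom.

  A part \<open>\<delta>\<eta>\<close> is inserted as follows. If there is no overlined multiple of \<open>\<eta>\<close> yet and there are at
  least \<open>\<delta>\<close> disjoint windows, advance the topmost \<open>\<delta>\<close> of them. Otherwise advance the topmost \<open>p\<close>
  windows and insert the overlined part \<open>(\<delta> - p)\<eta>\<close> below them, where \<open>p\<close> is determined uniquely by
  the distance condition. Insertion is reversible on the inserted sizes in increasing order: the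
  last insertion is recognised as the topmost overlined multiple of \<open>\<eta>\<close> or, if there is none,
  as the lowest window of wrong parity. The latter works since overlapping tight windows have equal
  parity, which is where \<open>k > \<lambda>\<close> enters. Inserting the parts of \<open>\<zeta>\<close> into \<open>\<mu>\<close> from the smallest to
  the largest gives the bijection.\<close>

text \<open>The coding makes one relation serve everywhere: \<open>above\<close> is the order of the
  list, in which only even codes (non-overlined parts) may repeat, it is the closeness that defines
  a tight window, and its failure is the distance condition. So condition (3) forbids
  \<open>w + 1\<close> consecutive close parts, and condition (5) concerns \<open>w\<close> of them.
  Reversing and negating a list respects order, tightness and distance; retreating is therefore
  advancing seen from below, and most facts are proved for one direction only. The obstacle is that
  a moved window may come too close to its neighbours. Advancing from the top never meets an unmoved
  window above. Retreating the upper part of a list needs free space below it, and this has two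
  sources: an overlined multiple just deleted there, or a window of wrong parity with only right
  ones below, since a window too close to it would share its parity. The bound (4) on small parts
  would be a boundary condition at the lower end. It disappears when \<open>w\<close> phantom parts
  that are not positive are appended to the list.\<close>

definition above :: "int \<Rightarrow> int \<Rightarrow> bool" where
  "above x y \<longleftrightarrow> y < x \<or> (x = y \<and> even x)"

definition neg :: "int list \<Rightarrow> int list" where
  "neg xs = rev (map uminus xs)"

lemma above_trans: "above x y \<Longrightarrow> above y z \<Longrightarrow> above x z"
  by (auto simp: above_def)

lemma above_uminus [simp]: "above (- x) (- y) \<longleftrightarrow> above y x"
  by (auto simp: above_def)

lemma neg_simps [simp]:
  "neg [] = []" "neg (x # xs) = neg xs @ [- x]" "neg (xs @ ys) = neg ys @ neg xs"
  "neg (neg xs) = xs" "length (neg xs) = length xs" "neg xs = [] \<longleftrightarrow> xs = []"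
  by (auto simp: neg_def rev_map o_def)

lemma neg_inject [simp]: "neg xs = neg ys \<longleftrightarrow> xs = ys"
  by (metis neg_simps(4))

lemma set_neg: "set (neg xs) = uminus ` set xs"
  by (auto simp: neg_def)

lemma nth_neg: "i < length xs \<Longrightarrow> neg xs ! i = - xs ! (length xs - 1 - i)"
  by (simp add: neg_def rev_nth)

section \<open>Valid lists, tight windows and their reflection\<close>

locale windows =
  fixes H :: int and w :: nat
  assumes H_pos: "0 < H" and H_even: "even H" and w_pos: "0 < w"
begin

definition tight :: "int list \<Rightarrow> bool" where
  "tight xs \<longleftrightarrow> w \<le> length xs \<and> above (xs ! (w - 1) + H) (xs ! 0)"

definition valid :: "int list \<Rightarrow> bool" where
  "valid xs \<longleftrightarrow> sorted_wrt above xs \<and>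
     (\<forall>i. i + w < length xs \<longrightarrow> \<not> above (xs ! (i + w) + H) (xs ! i))"

text \<open>What it takes to advance the first window of \<open>Z\<close> below a fixed
  \<open>L\<close>. A straddling window will receive the raised part in its middle and must not be
  close already. The raised part \<open>x + H\<close> may land \<open>w\<close> places after
  \<open>L ! (length L - w)\<close>, whence the distance \<open>2 * H\<close>.\<close>

definition separated :: "int list \<Rightarrow> int list \<Rightarrow> bool" where
  "separated L Z \<longleftrightarrow>
     (\<forall>j<length L. length L < j + w \<longrightarrow> \<not> tight (drop j (L @ Z))) \<and>
     (w \<le> length L \<and> w \<le> length Z \<longrightarrow> \<not> above (Z ! (w - 1) + 2 * H) (L ! (length L - w)))"

lemma above_add [simp]: "above (x + H) (y + H) \<longleftrightarrow> above x y"
  using H_even by (auto simp: above_def)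

lemma above_uminus_add: "above (- x + H) (- y) \<longleftrightarrow> above (y + H) x"
proof -
  have "even x = even y" if "- x + H = - y" using H_even that by presburger
  then show ?thesis by (auto simp: above_def)
qed

lemma above_uminus_add2: "above (- x + 2 * H) (- y) \<longleftrightarrow> above (y + 2 * H) x"
proof -
  have "even x = even y" if "- x + 2 * H = - y" using that by presburger
  then show ?thesis by (auto simp: above_def)
qed

lemma above_shift: "above (x + H) x"
  using H_pos by (auto simp: above_def)

lemma tight_append: "length W = w \<Longrightarrow> tight (W @ Y) \<longleftrightarrow> tight W"
  using w_pos by (auto simp: tight_def nth_append)

lemma tight_appendI: "tight X \<Longrightarrow> tight (X @ Y)"
  using w_pos by (auto simp: tight_def nth_append)

lemma tight_split:
  assumes "tight xs"
  obtains V x Y where "xs = V @ x # Y" "length V = w - 1" "above (x + H) (hd (V @ [x]))"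
proof -
  have l: "w - 1 < length xs" using assms w_pos by (auto simp: tight_def)
  have "xs = take (w - 1) xs @ xs ! (w - 1) # drop w xs"
    using id_take_nth_drop[OF l] w_pos by simp
  moreover have "hd (take (w - 1) xs @ [xs ! (w - 1)]) = xs ! 0"
    using l by (cases "w = 1") (auto simp: hd_append hd_conv_nth)
  ultimately show ?thesis
    using that[of "take (w - 1) xs" "xs ! (w - 1)" "drop w xs"] assms l by (auto simp: tight_def)
qed

lemma tight_window:
  assumes "length V = w - 1"
  shows "tight (V @ x # Y) \<longleftrightarrow> above (x + H) (hd (V @ [x]))"
  using assms w_pos by (cases V) (auto simp: tight_def nth_append)

lemma valid_appendD: "valid (xs @ ys) \<Longrightarrow> valid xs \<and> valid ys"
proof -
  assume v: "valid (xs @ ys)"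
  have "\<not> above (ys ! (i + w) + H) (ys ! i)" if "i + w < length ys" for i
  proof -
    have "\<not> above ((xs @ ys) ! (length xs + i + w) + H) ((xs @ ys) ! (length xs + i))"
      using v that unfolding valid_def by (metis add.assoc add_less_cancel_left length_append)
    then show ?thesis by (simp add: nth_append add.assoc)
  qed
  moreover have "\<not> above (xs ! (i + w) + H) (xs ! i)" if "i + w < length xs" for i
  proof -
    have "\<not> above ((xs @ ys) ! (i + w) + H) ((xs @ ys) ! i)"
      using v that unfolding valid_def by simp
    then show ?thesis using that by (simp add: nth_append)
  qed
  ultimately show ?thesis using v by (auto simp: valid_def sorted_wrt_append)
qed

lemma valid_Cons:
  "valid (x # xs) \<longleftrightarrow> valid xs \<and> (\<forall>y\<in>set xs. above x y) \<and>
     (w \<le> length xs \<longrightarrow> \<not> above (xs ! (w - 1) + H) x)"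
proof -
  have "(\<forall>i. i + w < length (x # xs) \<longrightarrow> \<not> above ((x # xs) ! (i + w) + H) ((x # xs) ! i)) \<longleftrightarrow>
    (\<forall>i. i + w < length xs \<longrightarrow> \<not> above (xs ! (i + w) + H) (xs ! i)) \<and>
    (w \<le> length xs \<longrightarrow> \<not> above (xs ! (w - 1) + H) x)" (is "(\<forall>i. ?P i) \<longleftrightarrow> ?Q")
  proof -
    have "(\<forall>i. ?P i) \<longleftrightarrow> ?P 0 \<and> (\<forall>i. ?P (Suc i))"
      by (metis not0_implies_Suc)
    then show ?thesis using w_pos by (auto simp: less_Suc_eq_le)
  qed
  then show ?thesis unfolding valid_def by auto
qed

lemma valid_far: "valid xs \<Longrightarrow> i + w \<le> j \<Longrightarrow> j < length xs \<Longrightarrow> \<not> above (xs ! j + H) (xs ! i)"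
proof
  assume v: "valid xs" and ij: "i + w \<le> j" "j < length xs" and d: "above (xs ! j + H) (xs ! i)"
  have "i + w < j \<Longrightarrow> above (xs ! (i + w)) (xs ! j)"
    using v ij by (auto simp: valid_def sorted_wrt_iff_nth_less)
  then have "above (xs ! (i + w) + H) (xs ! i)"
    using d ij above_trans by (metis above_add le_neq_implies_less)
  then show False using v ij by (auto simp: valid_def)
qed

lemma valid_nth_above: "valid xs \<Longrightarrow> i < j \<Longrightarrow> j < length xs \<Longrightarrow> above (xs ! i) (xs ! j)"
  by (auto simp: valid_def sorted_wrt_iff_nth_less)

lemma valid_neg_imp: "valid xs \<Longrightarrow> valid (neg xs)"
proof -
  assume v: "valid xs"
  have "above (neg xs ! i) (neg xs ! j)" if "i < j" "j < length xs" for i j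
    using v that by (simp add: nth_neg valid_nth_above)
  moreover have "\<not> above (neg xs ! (i + w) + H) (neg xs ! i)" if "i + w < length xs" for i
  proof
    let ?j = "length xs - 1 - (i + w)"
    assume "above (neg xs ! (i + w) + H) (neg xs ! i)"
    then have "above (- (xs ! ?j) + H) (- (xs ! (?j + w)))"
      using that by (simp add: nth_neg)
    then have "above (xs ! (?j + w) + H) (xs ! ?j)" by (simp only: above_uminus_add)
    moreover have "?j + w < length xs" using that w_pos by auto
    ultimately show False using valid_far[OF v, of ?j "?j + w"] by simp
  qed
  ultimately show ?thesis by (auto simp: valid_def sorted_wrt_iff_nth_less)
qed

lemma valid_neg [simp]: "valid (neg xs) \<longleftrightarrow> valid xs"
  using valid_neg_imp by fastforce

lemma tight_neg:
  assumes "length W = w"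
  shows "tight (neg W) \<longleftrightarrow> tight W"
proof -
  have "above (- W ! 0 + H) (- W ! (w - 1)) \<longleftrightarrow> above (W ! (w - 1) + H) (W ! 0)"
    by (rule above_uminus_add)
  then show ?thesis using assms w_pos by (simp add: tight_def nth_neg)
qed

lemma tight_drop: "tight (drop j xs) \<longleftrightarrow> j + w \<le> length xs \<and> above (xs ! (j + w - 1) + H) (xs ! j)"
  using w_pos by (auto simp: tight_def)

lemma tight_take: "tight xs \<longleftrightarrow> w \<le> length xs \<and> tight (take w xs)"
  using w_pos by (auto simp: tight_def)

lemma tight_drop_neg:
  assumes "j + w \<le> length xs"
  shows "tight (drop j (neg xs)) \<longleftrightarrow> tight (drop (length xs - w - j) xs)"
proof -
  let ?n = "length xs"
  have e: "take w (drop j (neg xs)) = neg (take w (drop (?n - w - j) xs))"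
    by (rule nth_equalityI) (use assms in \<open>auto simp: nth_neg algebra_simps\<close>)
  have "length (take w (drop (?n - w - j) xs)) = w" using assms by auto
  then show ?thesis
    using assms tight_take[of "drop j (neg xs)"] tight_take[of "drop (?n - w - j) xs"] e tight_neg
    by auto
qed

lemma separated_neg_imp: "separated X Y \<Longrightarrow> separated (neg Y) (neg X)"
proof -
  assume s: "separated X Y"
  have "\<not> tight (drop j (neg Y @ neg X))" if j: "j < length Y" "length Y < j + w" for j
  proof
    assume t: "tight (drop j (neg Y @ neg X))"
    then have le: "j + w \<le> length (X @ Y)" unfolding tight_drop by simp
    have "tight (drop (length (X @ Y) - w - j) (X @ Y))"
      using tight_drop_neg[OF le] t by simp
    moreover have "length (X @ Y) - w - j < length X" "length X < length (X @ Y) - w - j + w"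
      using j le by auto
    ultimately show False using s unfolding separated_def by blast
  qed
  moreover have "\<not> above (neg X ! (w - 1) + 2 * H) (neg Y ! (length Y - w))"
    if "w \<le> length X" "w \<le> length Y"
  proof
    assume d: "above (neg X ! (w - 1) + 2 * H) (neg Y ! (length Y - w))"
    have "above (- X ! (length X - w) + 2 * H) (- Y ! (w - 1))"
      using d that w_pos by (simp add: nth_neg)
    then have "above (Y ! (w - 1) + 2 * H) (X ! (length X - w))"
      by (simp only: above_uminus_add2)
    then show False using s that unfolding separated_def by blast
  qed
  ultimately show ?thesis unfolding separated_def by simp
qed

text \<open>Tightness puts \<open>x + H\<close> at or above the head of its window, so it becomes
  the new head and the rest of the window moves down one place. Any \<open>w + 1\<close> consecutive
  parts of the new list are then compared with at least as many old ones, or with a constraint from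
  \<open>separated\<close>.\<close>

lemma move_window:
  assumes v: "valid (L @ V @ x # Y)" and V: "length V = w - 1"
    and t: "tight (V @ [x])" and s: "separated L (V @ x # Y)"
  shows "valid (L @ (x + H) # V @ Y)"
proof -
  let ?a = "L @ V @ x # Y" and ?b = "L @ (x + H) # V @ Y" and ?l = "length L"
  have hd: "above (x + H) (hd (V @ [x]))" using t V tight_window by auto
  have b: "?b ! i = (if i < ?l then ?a ! i else if i = ?l then x + H
      else if i < ?l + w then ?a ! (i - 1) else ?a ! i)" for i
  proof -
    consider "i < ?l" | "i = ?l" | "?l < i" "i < ?l + w" | "?l + w \<le> i" by linarith
    then show ?thesis
    proof cases
      case 3
      then obtain n where "i = ?l + Suc n" "n < w - 1" by (metis add_diff_cancel_left' less_imp_Suc_add less_diff_conv nat_add_left_cancel_less Suc_eq_plus1 add_Suc_right)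
      then show ?thesis using V by (auto simp: nth_append)
    next
      case 4
      then obtain n where "i = ?l + Suc (w - 1 + n)" using w_pos by (metis Suc_diff_1 add_Suc add.assoc le_Suc_ex)
      then show ?thesis using V w_pos by (auto simp: nth_append)
    qed (auto simp: nth_append)
  qed
  have ax: "?a ! (?l + w - 1) = x" "?a ! ?l = hd (V @ [x])"
    using V w_pos by (auto simp: nth_append hd_conv_nth nth_Cons)
  \<comment> \<open>For \<open>w = 1\<close> this is the \<open>2 * H\<close> clause. For larger
    \<open>w\<close>, the window starting at \<open>last L\<close> ends with the part just before
    \<open>x\<close> and is not tight, so \<open>last L\<close> lies at least \<open>H\<close> above
    a part that is itself at or above \<open>x\<close>.\<close>
  have lastL: "above (last L) (x + H)" if "L \<noteq> []"
  proof (cases "w = 1")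
    case True
    have "w \<le> length L" "w \<le> length (V @ x # Y)" using True that by (cases L; simp)+
    then have "\<not> above ((V @ x # Y) ! (w - 1) + 2 * H) (L ! (length L - w))"
      using s unfolding separated_def by blast
    then have "\<not> above (x + 2 * H) (last L)" using True V that by (simp add: last_conv_nth)
    then show ?thesis using H_pos by (auto simp: above_def)
  next
    case False
    with w_pos have w2: "w \<ge> 2" by auto
    have nt: "\<not> above (?a ! (?l - 1 + w - 1) + H) (?a ! (?l - 1))"
    proof -
      have "?l - 1 < ?l" "?l < ?l - 1 + w" using that w2 by (cases L; simp)+
      then have "\<not> tight (drop (?l - 1) ?a)" using s unfolding separated_def by blast
      then show ?thesis unfolding tight_drop using V w2 that by (cases L) auto
    qed
    have l1: "?a ! (?l - 1) = last L" using that by (simp add: nth_append last_conv_nth)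
    have "above (?a ! (?l - 1 + w - 1)) (?a ! (?l + w - 1))"
      by (rule valid_nth_above[OF v]) (use w2 that V in \<open>cases L; auto\<close>)+
    then show ?thesis using nt unfolding l1 ax using H_even by (auto simp: above_def)
  qed
  have sa: "sorted_wrt above ?a" using v by (simp add: valid_def)
  have xV: "above (x + H) y" if "y \<in> set (V @ Y)" for y
  proof -
    have "hd (V @ [x]) = y \<or> above (hd (V @ [x])) y"
      using sa that by (cases V) (auto simp: sorted_wrt_append)
    then show ?thesis using hd above_trans by blast
  qed
  have Lx: "above y (x + H)" if "y \<in> set L" for y
  proof -
    have "L \<noteq> []" using that by auto
    moreover have "y = last L \<or> above y (last L)"
      using sa that by (cases L rule: rev_cases) (auto simp: sorted_wrt_append)
    ultimately show ?thesis using lastL above_trans by blast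
  qed
  have "sorted_wrt above ?b"
    using sa xV Lx by (auto simp: sorted_wrt_append)
  moreover have "\<not> above (?b ! (i + w) + H) (?b ! i)" if iw: "i + w < length ?b" for i
  proof -
    have la: "length ?a = length ?b" by simp
    consider "i + w < ?l \<or> ?l + w \<le> i" | "i + w = ?l" | "i < ?l" "?l < i + w"
      | "i = ?l" | "?l < i" "i < ?l + w" by linarith
    then show ?thesis
    proof cases
      case 1
      then have "?b ! (i + w) = ?a ! (i + w)" "?b ! i = ?a ! i" unfolding b using w_pos by auto
      then show ?thesis using valid_far[OF v, of i "i + w"] iw la by simp
    next
      case 2
      have "\<not> above ((V @ x # Y) ! (w - 1) + 2 * H) (L ! (?l - w))"
        using s 2 V w_pos unfolding separated_def by auto
      then have "\<not> above (x + 2 * H) (L ! i)" using V 2 by (simp add: nth_append) (metis diff_add_inverse2)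
      moreover have "?b ! (i + w) = x + H" "?b ! i = L ! i" unfolding b using 2 w_pos by (auto simp: nth_append)
      ultimately show ?thesis by (simp add: algebra_simps)
    next
      \<comment> \<open>The raised part lies between the two ends, so the other \<open>w\<close>
        parts were a straddling window of the old list.\<close>
      case 3
      have e: "?b ! (i + w) = ?a ! (i + w - 1)" "?b ! i = ?a ! i" unfolding b using 3 by auto
      have "\<not> tight (drop i ?a)" using s 3 unfolding separated_def by blast
      then show ?thesis using e 3 iw la unfolding tight_drop by simp
    next
      case 4
      have e: "?b ! (i + w) = ?a ! (?l + w)" "?b ! i = x + H" unfolding b using 4 w_pos by auto
      show ?thesis
      proof
        assume "above (?b ! (i + w) + H) (?b ! i)"
        then have "above (?a ! (?l + w) + H) (?a ! ?l)"
          using hd above_trans unfolding ax(2) e by blast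
        then show False using valid_far[OF v, of ?l "?l + w"] iw 4 la by simp
      qed
    next
      case 5
      have e: "?b ! (i + w) = ?a ! (i + w)" "?b ! i = ?a ! (i - 1)" unfolding b using 5 by auto
      show ?thesis using valid_far[OF v, of "i - 1" "i + w"] iw 5 la unfolding e by simp
    qed
  qed
  ultimately show ?thesis by (simp add: valid_def)
qed

section \<open>Advancing and retreating windows\<close>

function advance :: "int list \<Rightarrow> int list" where
  "advance xs = (if xs = [] then []
     else if tight xs then (xs ! (w - 1) + H) # take (w - 1) xs @ advance (drop w xs)
     else hd xs # advance (tl xs))"
  by auto
termination
  by (relation "measure length") (use w_pos in auto)

function count :: "int list \<Rightarrow> nat" where
  "count xs = (if xs = [] then 0 else if tight xs then Suc (count (drop w xs)) else count (tl xs))"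
  by auto
termination
  by (relation "measure length") (use w_pos in auto)

declare advance.simps [simp del] count.simps [simp del]

definition retreat :: "int list \<Rightarrow> int list" where
  "retreat xs = neg (advance (neg xs))"

lemma advance_Nil [simp]: "advance [] = []" and count_Nil [simp]: "count [] = 0"
  by (simp_all add: advance.simps count.simps)

lemma advance_Cons: "\<not> tight (x # xs) \<Longrightarrow> advance (x # xs) = x # advance xs"
  and count_Cons: "\<not> tight (x # xs) \<Longrightarrow> count (x # xs) = count xs"
  by (simp_all add: advance.simps[of "x # xs"] count.simps[of "x # xs"])

lemma advance_window:
  "length V = w - 1 \<Longrightarrow> tight (V @ x # Y) \<Longrightarrow> advance (V @ x # Y) = (x + H) # V @ advance Y"
  and count_window:
  "length V = w - 1 \<Longrightarrow> tight (V @ x # Y) \<Longrightarrow> count (V @ x # Y) = Suc (count Y)"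
  using w_pos
  by (simp_all add: advance.simps[of "V @ x # Y"] count.simps[of "V @ x # Y"] nth_append)

lemma tight_prefix: "w \<le> length X \<Longrightarrow> tight (X @ Y) \<longleftrightarrow> tight X"
  using w_pos by (auto simp: tight_def nth_append)

text \<open>The recursion of \<open>advance\<close> and \<open>count\<close> as an induction rule,
  with the smallest part \<open>x\<close> of the window split off because it is the one that
  moves.\<close>

lemma window_induct [case_names Nil window skip]:
  assumes "P []"
    and win: "\<And>V x Y. length V = w - 1 \<Longrightarrow> tight (V @ x # Y) \<Longrightarrow> P Y \<Longrightarrow> P (V @ x # Y)"
    and skip: "\<And>x Y. \<not> tight (x # Y) \<Longrightarrow> P Y \<Longrightarrow> P (x # Y)"
  shows "P xs"
proof (induction xs rule: length_induct)
  case (1 xs)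
  show ?case
  proof (cases "tight xs")
    case True
    then obtain V x Y where "xs = V @ x # Y" "length V = w - 1" by (rule tight_split)
    then show ?thesis using win 1 True by auto
  next
    case False
    then show ?thesis using assms(1) skip 1 by (cases xs) auto
  qed
qed

lemma length_advance [simp]: "length (advance xs) = length xs"
  by (induction xs rule: window_induct) (auto simp: advance_window advance_Cons)

lemma advance_short: "length xs < w \<Longrightarrow> advance xs = xs"
  and count_short: "length xs < w \<Longrightarrow> count xs = 0"
proof -
  have "length xs < w \<Longrightarrow> advance xs = xs \<and> count xs = 0"
  proof (induction xs)
    case (Cons x xs)
    then have "\<not> tight (x # xs)" by (simp add: tight_def)
    then show ?case using Cons by (simp add: advance_Cons count_Cons)
  qed simp
  then show "length xs < w \<Longrightarrow> advance xs = xs" "length xs < w \<Longrightarrow> count xs = 0" by auto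
qed

lemma count_0_advance: "count xs = 0 \<Longrightarrow> advance xs = xs"
  by (induction xs rule: window_induct) (auto simp: advance_window advance_Cons count_Cons count_window)

lemma tight_window_append: "length V = w - 1 \<Longrightarrow> tight (V @ x # Y @ Z) \<longleftrightarrow> tight (V @ x # Y)"
  by (metis Cons_eq_appendI append_assoc tight_window)

text \<open>The scan restarts at \<open>C\<close> unless it takes a window that begins in
  \<open>A\<close> and ends in \<open>C\<close>.\<close>

lemma advance_append:
  assumes "\<And>j. j < length A \<Longrightarrow> length A < j + w \<Longrightarrow> \<not> tight (drop j (A @ C))"
  shows "advance (A @ C) = advance A @ advance C \<and> count (A @ C) = count A + count C"
  using assms
proof (induction A rule: window_induct)
  case Nil
  then show ?case by simp
next
  case (window V x Y)
  have "\<not> tight (drop j (Y @ C))" if "j < length Y" "length Y < j + w" for j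
    using window.prems[of "length V + Suc j"] that by simp
  then have "advance (Y @ C) = advance Y @ advance C \<and> count (Y @ C) = count Y + count C"
    using window.IH by blast
  then show ?case using window.hyps
    by (simp add: advance_window count_window tight_window_append)
next
  case (skip x Y)
  have "\<not> tight (drop j (Y @ C))" if "j < length Y" "length Y < j + w" for j
    using skip.prems[of "Suc j"] that by simp
  then have IH: "advance (Y @ C) = advance Y @ advance C \<and> count (Y @ C) = count Y + count C"
    using skip.IH by blast
  have "\<not> tight (x # Y @ C)"
  proof (cases "length (x # Y) < w")
    case True
    then show ?thesis using skip.prems[of 0] by simp
  next
    case False
    then have "tight (x # Y @ C) = tight (x # Y)"
      using tight_prefix[of "x # Y" C] by simp
    then show ?thesis using skip.hyps by simp
  qed
  then show ?case using IH skip.hyps by (simp add: advance_Cons count_Cons)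
qed

text \<open>Restoring \<open>z\<close> would turn a tight window across the gap into
  \<open>w + 1\<close> close parts. This applies to a deleted overlined multiple as well as to the
  part that leaves the bottom of a window.\<close>

lemma deleted_not_tight:
  assumes v: "valid (A @ z # C)" and j: "j < length A" "length A < j + w"
  shows "\<not> tight (drop j (A @ C))"
proof
  assume "tight (drop j (A @ C))"
  then have t: "j + w \<le> length (A @ C)" "above ((A @ C) ! (j + w - 1) + H) ((A @ C) ! j)"
    unfolding tight_drop by auto
  have "(A @ C) ! (j + w - 1) = (A @ z # C) ! (j + w)" "(A @ C) ! j = (A @ z # C) ! j"
    using j by (auto simp: nth_append nth_Cons split: nat.split)
      (metis Suc_diff_Suc diff_Suc_1 diff_commute nat.inject zero_less_diff)
  then show False using valid_far[OF v, of j "j + w"] t by simp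
qed

text \<open>Maximum number of disjoint tight windows; being symmetric under \<^const>\<open>neg\<close>, it shows
  that the greedy counts from either end agree.\<close>

inductive pack :: "nat \<Rightarrow> int list \<Rightarrow> bool" where
  pack_0: "pack 0 xs"
| pack_skip: "pack n xs \<Longrightarrow> pack n (x # xs)"
| pack_window: "tight W \<Longrightarrow> length W = w \<Longrightarrow> pack n xs \<Longrightarrow> pack (Suc n) (W @ xs)"

text \<open>The two bounds need each other. If the scan takes a window at the head, dropping the
  head alone is compared with dropping the whole window, and the difference between the two is at
  most that one window.\<close>

lemma count_drop:
  "count (drop d xs) \<le> count xs \<and> (d \<le> w \<longrightarrow> count xs \<le> Suc (count (drop d xs)))"
proof (induction xs arbitrary: d rule: length_induct)
  case (1 xs)
  show ?case
  proof (cases d)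
    case (Suc e)
    show ?thesis
    proof (cases xs)
      case (Cons x ys)
      have IH: "count (drop e' zs) \<le> count zs \<and> (e' \<le> w \<longrightarrow> count zs \<le> Suc (count (drop e' zs)))"
        if "length zs \<le> length ys" for e' zs
        using 1 Cons that by auto
      show ?thesis
      proof (cases "tight xs")
        case False
        then show ?thesis using Cons Suc IH[of ys e] by (auto simp: count_Cons)
      next
        case True
        then have c: "count xs = Suc (count (drop (w - 1) ys))"
        proof -
          have "drop w xs = drop (w - 1) ys" using w_pos Cons by (cases w) auto
          then show ?thesis using True Cons count.simps[of xs] by simp
        qed
        have 1: "count ys \<le> count xs" using IH[of ys "w - 1"] c by simp
        moreover have "count (drop e ys) \<le> count ys" using IH[of ys] by blast
        moreover have "count (drop (w - 1) ys) \<le> count (drop e ys)" if "e < w"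
        proof -
          have "drop (w - 1) ys = drop (w - 1 - e) (drop e ys)" using that by simp
          then show ?thesis using IH[of "drop e ys" "w - 1 - e"] by simp
        qed
        ultimately show ?thesis using Cons Suc c by auto
      qed
    qed simp
  qed simp
qed

lemma count_Cons_le: "count xs \<le> count (x # xs)"
  using count_drop[of 1 "x # xs"] by simp

lemma pack_le_count: "pack n xs \<Longrightarrow> n \<le> count xs"
proof (induction rule: pack.induct)
  case (pack_skip n xs x)
  then show ?case using count_Cons_le[of xs x] by linarith
next
  case (pack_window W n xs)
  then have "W @ xs \<noteq> []" "tight (W @ xs)" using w_pos by (auto simp: tight_append)
  then show ?case using pack_window by (simp add: count.simps[of "W @ xs"])
qed simp

lemma pack_count: "pack (count xs) xs"
proof (induction xs rule: window_induct)
  case (window V x Y)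
  have "tight (V @ [x])" using window tight_window by auto
  then show ?case
    using window w_pos pack.pack_window[of "V @ [x]" "count Y" Y] by (simp add: count_window)
qed (auto simp: count_Cons intro: pack.intros)

lemma pack_append: "pack n xs \<Longrightarrow> pack l ys \<Longrightarrow> pack (n + l) (xs @ ys)"
proof (induction rule: pack.induct)
  case (pack_0 xs)
  then show ?case by (induction xs) (auto intro: pack.pack_skip)
next
  case (pack_window W n xs)
  then show ?case using pack.pack_window[of W "n + l" "xs @ ys"] by simp
qed (auto intro: pack.pack_skip)

lemma pack_neg: "pack n xs \<Longrightarrow> pack n (neg xs)"
proof (induction rule: pack.induct)
  case (pack_skip n xs x)
  then show ?case using pack_append[of n "neg xs" 0 "[- x]"] by (simp add: pack_0)
next
  case (pack_window W n xs)
  have "pack (Suc 0) (neg W @ [])"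
    by (rule pack.pack_window) (use pack_window tight_neg[of W] pack_0[of "[]"] in simp_all)
  then show ?case using pack_window pack_append[of n "neg xs" "Suc 0" "neg W"] by simp
qed (rule pack_0)

lemma count_neg [simp]: "count (neg xs) = count xs"
  by (metis eq_iff neg_simps(4) pack_count pack_le_count pack_neg)

lemma count_append_le: "count xs + count ys \<le> count (xs @ ys)"
  by (simp add: pack_append pack_count pack_le_count)

text \<open>Splits off the lowest window taken by the scan. This is the window that a scan from the
  bottom will meet first.\<close>

lemma last_window:
  assumes "0 < count xs"
  obtains X V x Y where "xs = X @ V @ x # Y" "length V = w - 1" "tight (V @ [x])"
    "advance xs = advance X @ (x + H) # V @ Y" "count xs = Suc (count X)" "count Y = 0"
    "advance (X @ V @ [x]) = advance X @ (x + H) # V" "count (X @ V @ [x]) = Suc (count X)"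
proof -
  have "\<exists>X V x Y. xs = X @ V @ x # Y \<and> length V = w - 1 \<and> tight (V @ [x]) \<and>
    advance xs = advance X @ (x + H) # V @ Y \<and> count xs = Suc (count X) \<and> count Y = 0 \<and>
    advance (X @ V @ [x]) = advance X @ (x + H) # V \<and> count (X @ V @ [x]) = Suc (count X)"
    using assms
  proof (induction xs rule: window_induct)
    case (window V x Y)
    have t: "tight (V @ [x])" using window tight_window by auto
    show ?case
    proof (cases "count Y = 0")
      case True
      then show ?thesis using window t
        by (intro exI[of _ "[]"] exI[of _ V] exI[of _ x] exI[of _ Y])
          (auto simp: advance_window count_window count_0_advance)
    next
      case False
      then obtain X V' x' Y' where IH: "Y = X @ V' @ x' # Y'" "length V' = w - 1"
        "tight (V' @ [x'])" "advance Y = advance X @ (x' + H) # V' @ Y'" "count Y = Suc (count X)"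
        "count Y' = 0" "advance (X @ V' @ [x']) = advance X @ (x' + H) # V'"
        "count (X @ V' @ [x']) = Suc (count X)"
        using window by blast
      have "tight (V @ x # Z)" for Z using window t tight_window by auto
      then show ?thesis using window.hyps IH
        by (intro exI[of _ "V @ x # X"] exI[of _ V'] exI[of _ x'] exI[of _ Y'])
          (auto simp: advance_window count_window)
    qed
  next
    case (skip h Y)
    then obtain X V x Y' where IH: "Y = X @ V @ x # Y'" "length V = w - 1"
        "tight (V @ [x])" "advance Y = advance X @ (x + H) # V @ Y'" "count Y = Suc (count X)"
        "count Y' = 0" "advance (X @ V @ [x]) = advance X @ (x + H) # V"
        "count (X @ V @ [x]) = Suc (count X)"
      by (auto simp: count_Cons)
    have "\<not> tight (h # X)" "\<not> tight (h # X @ V @ [x])"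
      using skip.hyps IH(1) tight_appendI[of "h # X" "V @ x # Y'"]
        tight_appendI[of "h # X @ V @ [x]" Y'] by auto
    then show ?case using IH skip.hyps
      by (intro exI[of _ "h # X"] exI[of _ V] exI[of _ x] exI[of _ Y'])
        (auto simp: advance_Cons count_Cons)
  qed simp
  then show ?thesis using that by blast
qed

lemma advance_skip:
  assumes "count (N @ V) = 0" "length V = w - 1" "tight (V @ [z])"
  shows "advance (N @ V @ z # Z) = N @ (z + H) # V @ advance Z \<and>
    count (N @ V @ z # Z) = Suc (count Z)"
  using assms
proof (induction N)
  case Nil
  then have "tight (V @ z # Z)" using tight_window by auto
  then show ?case using Nil by (simp add: advance_window count_window)
next
  case (Cons h N)
  have nt: "\<not> tight (h # N @ V)"
    using Cons.prems by (auto simp: count.simps[of "h # N @ V"])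
  then have "\<not> tight (h # N @ V @ z # Z)"
    using tight_prefix[of "h # N @ V" "z # Z"] Cons.prems(2) by simp
  then show ?case using Cons nt by (simp add: advance_Cons count_Cons)
qed

lemma count_delete:
  assumes "valid (V @ x # Y)" "length V = w - 1" "count Y = 0"
  shows "count (V @ Y) = 0"
proof -
  have "count (V @ Y) = count V + count Y"
    using advance_append deleted_not_tight[OF assms(1)] by blast
  then show ?thesis using assms w_pos by (simp add: count_short)
qed

text \<open>Induction on the number of windows, peeling off the lowest. After advancing it reads
  \<open>(x + H) # V\<close>. Below its head, \<open>V @ Y\<close> arises from
  \<open>V @ x # Y\<close> by deleting a part and so has no tight window; hence the scan from the
  bottom takes exactly this window and restores it.\<close>

lemma retreat_advance_count:
  "valid xs \<Longrightarrow> retreat (advance xs) = xs \<and> count (advance xs) = count xs"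
proof (induction "count xs" arbitrary: xs)
  case 0
  then show ?case by (simp add: count_0_advance retreat_def)
next
  case (Suc n)
  then obtain X V x Y where *: "xs = X @ V @ x # Y" "length V = w - 1" "tight (V @ [x])"
    "advance xs = advance X @ (x + H) # V @ Y" "count xs = Suc (count X)" "count Y = 0"
    using last_window by (metis zero_less_Suc)
  have vs: "valid X" "valid (V @ x # Y)" using Suc *(1) valid_appendD by blast+
  have "n = count X" using Suc.hyps(2) *(5) by simp
  then have IH: "neg (advance (neg (advance X))) = X" "count (advance X) = count X"
    using Suc.hyps(1) vs by (simp_all add: retreat_def)
  have t: "tight ((x + H) # V)" using * w_pos
  proof -
    have "x + H = hd ((x + H) # V)" by simp
    have sr: "sorted_wrt above (V @ [x])" using vs(2) valid_appendD[of "V @ [x]" Y] by (simp add: valid_def)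
    have "above (((x + H) # V) ! (w - 1)) x \<or> w = 1"
      using sr *(2) w_pos by (cases V rule: rev_cases) (auto simp: nth_append nth_Cons sorted_wrt_append split: nat.split)
    then show ?thesis using *(2) w_pos above_shift by (auto simp: tight_def)
  qed
  have "length ((x + H) # V) = w" using *(2) w_pos by simp
  then have t': "tight (neg V @ [- (x + H)])" using tight_neg[of "(x + H) # V"] t by simp
  have "count (neg Y @ neg V) = 0"
    using count_delete[OF vs(2)] *(2,6) count_neg[of "V @ Y"] by simp
  then have "advance (neg Y @ neg V @ (- (x + H)) # neg (advance X)) =
    neg Y @ (- (x + H) + H) # neg V @ advance (neg (advance X)) \<and>
    count (neg Y @ neg V @ (- (x + H)) # neg (advance X)) = Suc (count (neg (advance X)))"
    by (rule advance_skip) (use *(2) t' in auto)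
  moreover have "neg (advance xs) = neg Y @ neg V @ (- (x + H)) # neg (advance X)" using *(4) by simp
  ultimately have "retreat (advance xs) = neg (advance (neg (advance X))) @ V @ x # Y"
    "count (neg (advance xs)) = Suc (count X)"
    using IH by (simp_all add: retreat_def)
  then show ?case using IH *(1,5) by simp
qed

lemma retreat_advance: "valid xs \<Longrightarrow> retreat (advance xs) = xs"
  and count_advance: "valid xs \<Longrightarrow> count (advance xs) = count xs"
  using retreat_advance_count by blast+

lemma advance_retreat: "valid xs \<Longrightarrow> advance (retreat xs) = xs"
  using retreat_advance[of "neg xs"] by (simp add: retreat_def)

lemma retreat_Nil [simp]: "retreat [] = []" and length_retreat [simp]: "length (retreat xs) = length xs"
  by (simp_all add: retreat_def)

lemma advance_props:
  "(\<forall>y\<in>set (advance xs). y \<in> set xs \<or> y - H \<in> set xs) \<and>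
   (\<Sum>y\<leftarrow>advance xs. y div 2) = (\<Sum>y\<leftarrow>xs. y div 2) + (H div 2) * int (count xs)"
proof (induction xs rule: window_induct)
  case (window V x Y)
  have "(x + H) div 2 = x div 2 + H div 2" using H_even by presburger
  then show ?case using window by (auto simp: advance_window count_window algebra_simps)
qed (auto simp: advance_Cons count_Cons)

section \<open>Validity after advancing and retreating\<close>

lemma separated_Nil [simp]: "separated [] Z"
  using w_pos by (simp add: separated_def)

text \<open>The scan invariant after passing a window. Windows across the new boundary lack the
  moved part \<open>x\<close>, so they are not tight; the \<open>2 * H\<close> clause is the old
  distance condition at \<open>x\<close>, shifted by \<open>H\<close>.\<close>

lemma separated_window:
  assumes v: "valid (L @ V @ x # Y)" and V: "length V = w - 1"
    and s: "separated L (V @ x # Y)"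
  shows "separated (L @ (x + H) # V) Y"
proof -
  have v': "valid (V @ x # Y)" using v valid_appendD by blast
  have "\<not> tight (drop j ((L @ (x + H) # V) @ Y))"
    if j: "j < length (L @ (x + H) # V)" "length (L @ (x + H) # V) < j + w" for j
  proof -
    have "length L < j" using j V w_pos by simp
    then obtain i where i: "j = length L + Suc i" using less_imp_Suc_add by auto
    then have "drop j ((L @ (x + H) # V) @ Y) = drop i (V @ Y)" by simp
    then show ?thesis using deleted_not_tight[OF v', of i] i j V by simp
  qed
  moreover have "\<not> above (Y ! (w - 1) + 2 * H) ((L @ (x + H) # V) ! (length (L @ (x + H) # V) - w))"
    if "w \<le> length Y"
  proof -
    have e: "(L @ (x + H) # V) ! (length (L @ (x + H) # V) - w) = x + H"
      using V w_pos by (auto simp: nth_append)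
    have "\<not> above (Y ! (w - 1) + H) x"
      using valid_appendD[OF v'] that by (simp add: valid_Cons)
    then show ?thesis unfolding e using above_add[of "Y ! (w - 1) + H" x] by (simp add: algebra_simps)
  qed
  ultimately show ?thesis unfolding separated_def by blast
qed

text \<open>The scan invariant after skipping \<open>h\<close>. The \<open>2 * H\<close> clause adds
  two distances: from the \<open>w\<close>-th part of \<open>Z\<close> up to \<open>h\<close> by
  validity, and from \<open>h\<close> up into \<open>L\<close> because no straddling window is
  tight.\<close>

lemma separated_skip:
  assumes v: "valid (L @ h # Z)" and t: "\<not> tight (h # Z)" and s: "separated L (h # Z)"
  shows "separated (L @ [h]) Z"
proof -
  have vZ: "valid (h # Z)" using v valid_appendD by blast
  have "\<not> tight (drop j ((L @ [h]) @ Z))" if j: "j < length (L @ [h])" "length (L @ [h]) < j + w" for j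
  proof (cases "j = length L")
    case True
    then show ?thesis using t by simp
  next
    case False
    then show ?thesis using s j unfolding separated_def by simp
  qed
  moreover have "\<not> above (Z ! (w - 1) + 2 * H) ((L @ [h]) ! (length (L @ [h]) - w))"
    if l: "w \<le> length (L @ [h])" "w \<le> length Z"
  proof -
    have w2: "w \<noteq> 1" using t above_shift by (auto simp: tight_def)
    let ?j = "length (L @ [h]) - w"
    have j: "?j < length L" "length L < ?j + w" using l w2 w_pos by auto
    have "\<not> tight (drop ?j (L @ h # Z))" using s j unfolding separated_def by blast
    moreover have "(L @ h # Z) ! (?j + w - 1) = h" "(L @ h # Z) ! ?j = (L @ [h]) ! ?j"
      using j l by (auto simp: nth_append)
    ultimately have nt: "\<not> above (h + H) ((L @ [h]) ! ?j)"
      unfolding tight_drop using l by simp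
    have "\<not> above (Z ! (w - 1) + H) h" using vZ l(2) by (simp add: valid_Cons)
    then have "Z ! (w - 1) + H < h \<or> (Z ! (w - 1) + H = h)" by (auto simp: above_def)
    then have "Z ! (w - 1) + 2 * H < h + H \<or> Z ! (w - 1) + 2 * H = h + H" by auto
    then show ?thesis using nt by (auto simp: above_def)
  qed
  ultimately show ?thesis unfolding separated_def by blast
qed

lemma valid_advance:
  assumes "valid (L @ X @ Y)" "separated L (X @ Y)"
  shows "valid (L @ advance X @ Y)"
  using assms
proof (induction X arbitrary: L rule: window_induct)
  case (window V x Z)
  have t: "tight (V @ [x])" using window tight_window by auto
  have "valid (L @ (x + H) # V @ Z @ Y)" using move_window[of L V x "Z @ Y"] window t by simp
  moreover have "separated (L @ (x + H) # V) (Z @ Y)"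
    using separated_window[of L V x "Z @ Y"] window by simp
  ultimately show ?case
    using window.IH[of "L @ (x + H) # V"] window.hyps by (simp add: advance_window)
next
  case (skip x Z)
  show ?case
  \<comment> \<open>In the short case a tight window may start at \<open>x\<close> and end in
    \<open>Y\<close>, but nothing in the rest of \<open>X\<close> moves any more.\<close>
  proof (cases "length (x # Z) < w")
    case True
    then show ?thesis using skip.prems by (simp add: advance_short)
  next
    case False
    then have "\<not> tight (x # Z @ Y)"
      using skip.hyps tight_prefix[of "x # Z" Y] by simp
    then have "separated (L @ [x]) (Z @ Y)" using separated_skip[of L x "Z @ Y"] skip.prems by simp
    then show ?thesis using skip.IH[of "L @ [x]"] skip.prems skip.hyps by (simp add: advance_Cons)
  qed
qed simp

lemma valid_advance': "valid (X @ Y) \<Longrightarrow> valid (advance X @ Y)"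
  using valid_advance[of "[]"] by simp

text \<open>Under reflection the parts below \<open>X\<close> become parts above it, so here the
  space has to be provided by \<open>separated\<close>.\<close>

lemma valid_retreat:
  assumes "valid (X @ Y)" "separated X Y"
  shows "valid (retreat X @ Y)"
proof -
  have "valid (neg Y @ neg X @ [])" using assms(1) valid_neg[of "X @ Y"] by simp
  then have "valid (neg Y @ advance (neg X) @ [])"
    by (rule valid_advance) (use separated_neg_imp[OF assms(2)] in simp)
  then show ?thesis using valid_neg[of "retreat X @ Y"] by (simp add: retreat_def)
qed

section \<open>Inserting an overlined multiple\<close>

lemma sorted_hd:
  "sorted_wrt above ys \<Longrightarrow> y \<in> set ys \<Longrightarrow> y \<le> hd ys"
  by (cases ys) (auto simp: above_def intro: less_imp_le)

lemma above_less: "above x y \<Longrightarrow> x \<le> z \<Longrightarrow> odd z \<Longrightarrow> y < z"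
  by (cases "y = z") (auto simp: above_def)

text \<open>The distances from \<open>z\<close> to the parts \<open>w\<close> places above and below
  it add up to \<open>2 * H\<close>: after the deletion, \<open>X\<close> has the space it needs to
  retreat.\<close>

lemma valid_delete:
  assumes v: "valid (X @ z # Y)"
  shows "valid (X @ Y)" "separated X Y"
proof -
  let ?a = "X @ z # Y" and ?l = "length X"
  have nth: "(X @ Y) ! i = ?a ! (if i < ?l then i else Suc i)" for i
    by (auto simp: nth_append Suc_diff_le)
  have "\<not> above ((X @ Y) ! (i + w) + H) ((X @ Y) ! i)" if "i + w < length (X @ Y)" for i
    unfolding nth by (rule valid_far[OF v]) (use that in auto)
  then show "valid (X @ Y)" using v by (auto simp: valid_def sorted_wrt_append)
  have "\<not> above (Y ! (w - 1) + 2 * H) (X ! (?l - w))" if "w \<le> ?l" "w \<le> length Y"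
  proof -
    have "\<not> above (?a ! (?l + w) + H) (?a ! ?l)" "\<not> above (?a ! ?l + H) (?a ! (?l - w))"
      by (rule valid_far[OF v]; use that w_pos in simp)+
    then have "\<not> above (Y ! (w - 1) + H) z" "\<not> above (z + H) (X ! (?l - w))"
      using that w_pos by (auto simp: nth_append split: if_splits)
    then show ?thesis using H_even by (auto simp: above_def)
  qed
  then show "separated X Y" unfolding separated_def using deleted_not_tight[OF v] by blast
qed

lemma valid_insert:
  assumes v: "valid (L @ Z)" and s: "separated L Z" and "odd z"
    and L: "L = [] \<or> z < last L" "w \<le> length L \<longrightarrow> \<not> above (z + H) (L ! (length L - w))"
    and Z: "Z = [] \<or> hd Z < z" "w \<le> length Z \<longrightarrow> Z ! (w - 1) + H \<le> z"
  shows "valid (L @ z # Z)"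
proof -
  let ?a = "L @ Z" and ?b = "L @ z # Z" and ?l = "length L"
  have sa: "sorted_wrt above ?a" using v by (simp add: valid_def)
  have "above y z" if "y \<in> set L" for y
  proof -
    have "y = last L \<or> above y (last L)"
      using sa that by (cases L rule: rev_cases) (auto simp: sorted_wrt_append)
    then show ?thesis using that L(1) by (auto simp: above_def)
  qed
  moreover have "above z y" if "y \<in> set Z" for y
    using sorted_hd[of Z y] sa that Z(1) by (auto simp: above_def sorted_wrt_append)
  ultimately have "sorted_wrt above ?b" using sa by (auto simp: sorted_wrt_append)
  moreover have "\<not> above (?b ! (i + w) + H) (?b ! i)" if iw: "i + w < length ?b" for i
  proof -
    consider "i + w < ?l" | "i + w = ?l" | "i < ?l" "?l < i + w" | "i = ?l" | "?l < i" by linarith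
    then show ?thesis
    proof cases
      case 1
      then have "?b ! (i + w) = ?a ! (i + w)" "?b ! i = ?a ! i" by (simp_all add: nth_append)
      then show ?thesis using valid_far[OF v, of i "i + w"] iw 1 by simp
    next
      case 2
      then have i: "i = ?l - w" "w \<le> ?l" "i < ?l" using w_pos by auto
      have "?b ! (i + w) = z" "?b ! i = L ! i" using 2 i(3) by (simp_all add: nth_append)
      then show ?thesis using L(2) i by simp
    next
      case 3
      then obtain n where n: "i + w = ?l + Suc n" using less_imp_Suc_add by auto
      then have "?b ! (i + w) = ?a ! (i + w - 1)" "?b ! i = ?a ! i"
        using 3(1) by (simp_all add: nth_append)
      moreover have "\<not> tight (drop i ?a)" using s 3 unfolding separated_def by blast
      ultimately show ?thesis using iw 3 unfolding tight_drop by simp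
    next
      case 4
      then have e: "?b ! (i + w) = Z ! (w - 1)" "?b ! i = z" "w \<le> length Z"
        using w_pos iw by (simp_all add: nth_append)
      have "Z ! (w - 1) + H \<le> z" using Z(2) e(3) by blast
      then show ?thesis unfolding e using \<open>odd z\<close> by (auto simp: above_def)
    next
      case 5
      then obtain n where n: "i = ?l + Suc n" using less_imp_Suc_add by auto
      have "\<not> above (?a ! (?l + n + w) + H) (?a ! (?l + n))"
        by (rule valid_far[OF v]) (use iw n in auto)
      then show ?thesis unfolding n by (simp add: nth_append)
    qed
  qed
  ultimately show ?thesis by (simp add: valid_def)
qed

text \<open>The code of the overlined part of size \<open>d\<close> times \<eta>, as
  \<open>H\<close> is twice \<eta>.\<close>

definition bar :: "int \<Rightarrow> int" where
  "bar d = d * H + 1"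

lemma odd_bar [simp]: "odd (bar d)"
  using H_even by (simp add: bar_def)

lemma bar_less [simp]: "bar c < bar d \<longleftrightarrow> c < d" and bar_le [simp]: "bar c \<le> bar d \<longleftrightarrow> c \<le> d"
  using mult_less_cancel_right_pos[OF H_pos, of c d] mult_le_cancel_right_pos[OF H_pos, of c d]
  unfolding bar_def by linarith+

lemma bar_mod: "bar d mod H = 1"
proof -
  have "1 < H" using H_pos H_even by (cases "H = 1") auto
  then show ?thesis by (simp add: bar_def)
qed

lemma bar_pred: "bar (d - 1) = bar d - H"
  by (simp add: bar_def algebra_simps)

text \<open>Scan from the largest part: a tight window above \<open>bar (d - 1)\<close> is passed by advancing it,
  at the cost of one unit of \<open>d\<close>.\<close>

function insert_bar :: "int \<Rightarrow> int list \<Rightarrow> int list" where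
  "insert_bar d xs = (if xs = [] then [bar d]
     else if tight xs then
       (if bar (d - 1) < xs ! (w - 1)
        then (xs ! (w - 1) + H) # take (w - 1) xs @ insert_bar (d - 1) (drop w xs)
        else bar d # xs)
     else if hd xs < bar d then bar d # xs
     else hd xs # insert_bar d (tl xs))"
  by auto
termination
  by (relation "measure (length \<circ> snd)") (use w_pos in auto)

declare insert_bar.simps [simp del]

lemma insert_bar_Nil [simp]: "insert_bar d [] = [bar d]"
  by (simp add: insert_bar.simps)

lemma insert_bar_window:
  "length V = w - 1 \<Longrightarrow> tight (V @ x # Y) \<Longrightarrow> bar (d - 1) < x \<Longrightarrow>
     insert_bar d (V @ x # Y) = (x + H) # V @ insert_bar (d - 1) Y"
  using w_pos by (simp add: insert_bar.simps[of d "V @ x # Y"] nth_append)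

lemma insert_bar_stop:
  "tight xs \<Longrightarrow> xs ! (w - 1) \<le> bar (d - 1) \<Longrightarrow> insert_bar d xs = bar d # xs"
  "\<not> tight xs \<Longrightarrow> xs = [] \<or> hd xs < bar d \<Longrightarrow> insert_bar d xs = bar d # xs"
  by (cases "xs = []"; simp add: insert_bar.simps[of d xs])+

lemma insert_bar_skip:
  "\<not> tight (x # xs) \<Longrightarrow> bar d \<le> x \<Longrightarrow> insert_bar d (x # xs) = x # insert_bar d xs"
  by (simp add: insert_bar.simps[of d "x # xs"])

text \<open>Each way of stopping puts the \<open>w\<close>-th part of \<open>Z\<close> at least
  \<open>H\<close> below \<open>bar d\<close>: directly if \<open>Z\<close> is tight, and otherwise
  because that part is at least \<open>H\<close> below \<open>hd Z\<close>.\<close>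

lemma valid_insert_bar_stop:
  assumes v: "valid (L @ Z)" and s: "separated L Z"
    and L: "L = [] \<or> bar d < last L" "w \<le> length L \<longrightarrow> \<not> above (bar d + H) (L ! (length L - w))"
    and stop: "(tight Z \<and> Z ! (w - 1) \<le> bar (d - 1)) \<or> (\<not> tight Z \<and> (Z = [] \<or> hd Z < bar d))"
  shows "valid (L @ bar d # Z)"
proof (rule valid_insert[OF v s odd_bar L])
  have hd0: "Z \<noteq> [] \<Longrightarrow> Z ! 0 = hd Z" by (simp add: hd_conv_nth)
  show "Z = [] \<or> hd Z < bar d"
  proof (cases "tight Z")
    case True
    then have a: "above (Z ! (w - 1) + H) (hd Z)" "Z ! (w - 1) + H \<le> bar d"
      using stop hd0 w_pos by (cases Z; auto simp: tight_def bar_pred)+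
    then show ?thesis using above_less odd_bar by blast
  qed (use stop in auto)
  show "w \<le> length Z \<longrightarrow> Z ! (w - 1) + H \<le> bar d"
  proof (cases "tight Z")
    case False
    show ?thesis
    proof
      assume l: "w \<le> length Z"
      then have "Z \<noteq> []" using w_pos by auto
      then show "Z ! (w - 1) + H \<le> bar d"
        using False stop l hd0 by (auto simp: tight_def above_def)
    qed
  qed (use stop in \<open>auto simp: bar_pred\<close>)
qed

text \<open>\<open>L\<close> collects what the scan has passed, and two hypotheses keep it clear of
  \<open>bar d\<close>. \<open>Z\<close> begins at the previous topmost overlined multiple or at the
  phantom parts. A passed window costs one unit of \<open>d\<close>, and \<open>U\<close> has only
  \<open>count U\<close> of them, so the new multiple stays above \<open>bar b'\<close> and the scan
  stops within \<open>U\<close>.\<close>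

lemma insert_bar_spec:
  assumes "valid (L @ U @ Z)" "separated L (U @ Z)"
    and "L = [] \<or> bar d < last L" "w \<le> length L \<longrightarrow> \<not> above (bar d + H) (L ! (length L - w))"
    and "\<forall>u\<in>set U. u mod H \<noteq> 1" "Z = [] \<or> hd Z \<le> bar b'" "b' + int (count U) < d"
  shows "\<exists>X V b. U = X @ V \<and> insert_bar d (U @ Z) = advance X @ bar b # V @ Z \<and> b' < b \<and>
    b + int (count X) = d \<and> valid (L @ insert_bar d (U @ Z))"
  using assms
proof (induction U arbitrary: L d rule: length_induct)
  case (1 U)
  note prems = 1(2-)
  have IH: "\<exists>X V b. U' = X @ V \<and> insert_bar d (U' @ Z) = advance X @ bar b # V @ Z \<and> b' < b \<and>
    b + int (count X) = d \<and> valid (L @ insert_bar d (U' @ Z))"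
    if "length U' < length U" "valid (L @ U' @ Z)" "separated L (U' @ Z)"
     "L = [] \<or> bar d < last L" "w \<le> length L \<longrightarrow> \<not> above (bar d + H) (L ! (length L - w))"
     "\<forall>u\<in>set U'. u mod H \<noteq> 1" "b' + int (count U') < d" for U' L d
    using 1(1) that prems(6) by blast
  have vU: "valid (U @ Z)" using prems(1) valid_appendD by blast
  have Zle: "y \<le> bar b'" if "y \<in> set Z" for y
  proof -
    have "valid Z" using vU valid_appendD by blast
    then have "y \<le> hd Z" using sorted_hd[of Z y] that by (simp add: valid_def)
    then show ?thesis using prems(6) that by auto
  qed
  have stop: ?case
    if "(tight (U @ Z) \<and> (U @ Z) ! (w - 1) \<le> bar (d - 1)) \<or>
        (\<not> tight (U @ Z) \<and> (U @ Z = [] \<or> hd (U @ Z) < bar d))"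
  proof -
    have "insert_bar d (U @ Z) = bar d # U @ Z"
      using that insert_bar_stop by blast
    moreover have "valid (L @ bar d # U @ Z)"
      using valid_insert_bar_stop prems(1-4) that by blast
    ultimately show ?thesis using prems(7)
      by (intro exI[of _ "[]"] exI[of _ U] exI[of _ d]) simp
  qed
  show ?case
  proof (cases "tight (U @ Z)")
    case True
    show ?thesis
    proof (cases "bar (d - 1) < (U @ Z) ! (w - 1)")
      case False
      then show ?thesis using stop True by simp
    next
      case pass: True
      \<comment> \<open>A window that reaches into \<open>Z\<close> ends with a part of at most
        \<open>bar b'\<close>, too small to be passed.\<close>
      have lU: "w \<le> length U"
      proof (rule ccontr)
        assume "\<not> w \<le> length U"
        then have "(U @ Z) ! (w - 1) \<in> set Z" using True by (auto simp: tight_def nth_append)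
        then show False using Zle[of "(U @ Z) ! (w - 1)"] pass prems(7) bar_le[of b' "d - 1"] by linarith
      qed
      then have "tight U" using True tight_prefix by blast
      then obtain V x Y where U: "U = V @ x # Y" "length V = w - 1" by (rule tight_split)
      have x: "bar (d - 1) < x" using pass U w_pos by (simp add: nth_append)
      have tV: "tight (V @ x # Y')" for Y' using \<open>tight U\<close> U tight_window by auto
      have "tight (V @ [x])" using tV by simp
      then have v2: "valid ((L @ (x + H) # V) @ Y @ Z)"
        using move_window[of L V x "Y @ Z"] prems(1,2) U by simp
      have s2: "separated (L @ (x + H) # V) (Y @ Z)"
        using separated_window[of L V x "Y @ Z"] prems(1,2) U by simp
      have "x \<le> last ((x + H) # V)"
      proof -
        have "sorted_wrt above (V @ [x])" using vU U by (auto simp: valid_def sorted_wrt_append)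
        then show ?thesis using H_pos by (cases V rule: rev_cases) (auto simp: sorted_wrt_append above_def)
      qed
      then have l2: "bar (d - 1) < last (L @ (x + H) # V)" using x by simp
      have e: "(L @ (x + H) # V) ! (length (L @ (x + H) # V) - w) = x + H"
        using U(2) w_pos by (auto simp: nth_append)
      have f2: "\<not> above (bar (d - 1) + H) ((L @ (x + H) # V) ! (length (L @ (x + H) # V) - w))"
        unfolding e using x by (simp add: above_def)
      have cU: "count U = Suc (count Y)" using U tV by (simp add: count_window)
      obtain X V' b where *: "Y = X @ V'" "insert_bar (d - 1) (Y @ Z) = advance X @ bar b # V' @ Z"
        "b' < b" "b + int (count X) = d - 1"
        "valid ((L @ (x + H) # V) @ insert_bar (d - 1) (Y @ Z))"
        using IH[of Y "L @ (x + H) # V" "d - 1"] v2 s2 l2 f2 U(1) prems(5,7) cU by auto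
      have "insert_bar d (U @ Z) = (x + H) # V @ insert_bar (d - 1) (Y @ Z)"
        using insert_bar_window[of V x "Y @ Z" d] U tV x by simp
      then show ?thesis using * U tV
        by (intro exI[of _ "V @ x # X"] exI[of _ V'] exI[of _ b])
          (auto simp: advance_window count_window)
    qed
  next
    case nt: False
    show ?thesis
    proof (cases "U @ Z = [] \<or> hd (U @ Z) < bar d")
      case True
      then show ?thesis using stop nt by simp
    next
      case False
      then have big: "U @ Z \<noteq> []" "bar d \<le> hd (U @ Z)" by auto
      have "U \<noteq> []"
      proof
        assume "U = []"
        then have "Z \<noteq> []" "bar d \<le> hd Z" using big by auto
        then have "bar d \<le> bar b'" using prems(6) order_trans by blast
        then show False using prems(7) by simp
      qed
      then obtain h Y where U: "U = h # Y" by (cases U) auto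
      have h: "bar d < h" using big(2) U prems(5) bar_mod[of d] by (auto simp: order.order_iff_strict)
      have s2: "separated (L @ [h]) (Y @ Z)"
        using separated_skip[of L h "Y @ Z"] prems(1,2) nt U by simp
      have f2: "\<not> above (bar d + H) ((L @ [h]) ! (length (L @ [h]) - w))" if l: "w \<le> length (L @ [h])"
      proof
        let ?j = "length (L @ [h]) - w"
        assume a: "above (bar d + H) ((L @ [h]) ! ?j)"
        show False
        proof (cases "w = 1")
          case True
          have "tight (h # Y @ Z)" unfolding tight_def by (simp add: True above_shift)
          then show False using nt U by simp
        next
          case False
          then have j: "?j < length L" "length L < ?j + w" using l w_pos by auto
          then have "\<not> tight (drop ?j (L @ U @ Z))" using prems(2) unfolding separated_def by blast
          moreover have "(L @ U @ Z) ! (?j + w - 1) = h" "(L @ U @ Z) ! ?j = (L @ [h]) ! ?j"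
            using j l U by (auto simp: nth_append)
          ultimately have "\<not> above (h + H) ((L @ [h]) ! ?j)" unfolding tight_drop using l U by simp
          then show False using a h by (auto simp: above_def)
        qed
      qed
      have ntU: "\<not> tight (h # Y')" if "\<exists>Y''. Y @ Z = Y' @ Y''" for Y'
        using nt U that tight_appendI[of "h # Y'"] by auto
      have cU: "count U = count Y" using U ntU[of Y] by (simp add: count_Cons)
      obtain X V' b where *: "Y = X @ V'" "insert_bar d (Y @ Z) = advance X @ bar b # V' @ Z"
        "b' < b" "b + int (count X) = d"
        "valid ((L @ [h]) @ insert_bar d (Y @ Z))"
        using IH[of Y "L @ [h]" d] prems(1,5,7) s2 f2 U cU h by auto
      have "\<not> tight (h # X)" using ntU[of X] *(1) by auto
      moreover have "insert_bar d (U @ Z) = h # insert_bar d (Y @ Z)"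
        using insert_bar_skip nt U h by simp
      ultimately show ?thesis using * U
        by (intro exI[of _ "h # X"] exI[of _ V'] exI[of _ b])
          (auto simp: advance_Cons count_Cons)
    qed
  qed
qed

text \<open>In the advanced list, the part \<open>w\<close> places below the head of a window is at
  least \<open>H\<close> smaller, so the windows stack up in steps of \<open>H\<close>. This keeps
  the scan in \<open>insert_bar\<close> from stopping too early.\<close>

lemma advance_hd_bound:
  "valid (advance X @ z # Y) \<Longrightarrow> z + H * int (count X) \<le> hd (advance X @ [z])"
proof (induction X rule: window_induct)
  case (window V x Z)
  let ?T = "advance Z @ z # Y"
  have v: "valid ((x + H) # V @ ?T)" using window by (simp add: advance_window)
  then have "valid ?T" using valid_appendD[of "(x + H) # V" ?T] by simp
  then have IH: "z + H * int (count Z) \<le> hd (advance Z @ [z])" using window by blast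
  have "\<not> above ((V @ ?T) ! (w - 1) + H) (x + H)" using v window(1) w_pos by (auto simp: valid_Cons)
  moreover have "(V @ ?T) ! (w - 1) = hd (advance Z @ [z])"
    using window(1) by (cases "advance Z") (auto simp: nth_append)
  ultimately show ?case using IH window(1,2) by (auto simp: advance_window count_window above_def algebra_simps)
next
  case (skip h Z)
  have v: "valid (h # advance Z @ z # Y)" using skip by (simp add: advance_Cons)
  then have "z + H * int (count Z) \<le> hd (advance Z @ [z])" using skip by (simp add: valid_Cons)
  moreover have "above h (hd (advance Z @ [z]))" using v by (cases "advance Z") (auto simp: valid_Cons)
  ultimately show ?case using skip.hyps by (auto simp: advance_Cons count_Cons above_def)
qed simp

text \<open>The same stacking for windows that have not moved. It limits the number of windows below
  an overlined multiple by its size.\<close>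

lemma count_bound:
  assumes "valid (h # Y)" "\<forall>y\<in>set (h # Y). t < y"
  shows "t + H * int (count Y) < h"
  using assms
proof (induction Y arbitrary: h rule: window_induct)
  case (window V x Z)
  have "valid (V @ x # Z)" using window.prems by (simp add: valid_Cons)
  then have "valid (x # Z)" using valid_appendD by blast
  then have IH: "t + H * int (count Z) < x" using window by simp
  have "\<not> above ((V @ x # Z) ! (w - 1) + H) h" using window.prems window.hyps w_pos by (auto simp: valid_Cons)
  then have "x + H \<le> h" using window.hyps by (auto simp: nth_append above_def)
  then show ?case using IH window.hyps by (simp add: count_window algebra_simps)
next
  case (skip x Z)
  then have "t + H * int (count Z) < x" by (simp add: valid_Cons)
  moreover have "above h x" using skip.prems by (simp add: valid_Cons)
  ultimately show ?case using skip.hyps by (auto simp: count_Cons above_def)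
qed simp

lemma deleted_head_not_tight:
  assumes "\<not> tight (h # X)" "valid (h # advance X @ z # Y)"
  shows "\<not> tight (h # X @ Y)"
proof (cases "w \<le> length (h # X)")
  case True
  then show ?thesis using tight_prefix[of "h # X" Y] assms(1) by simp
next
  case False
  then have "valid ((h # X) @ z # Y)" using assms by (simp add: advance_short)
  then show ?thesis using deleted_not_tight[of "h # X" z Y 0] False by simp
qed

text \<open>The uniqueness of the stopping place: \<open>advance_hd_bound\<close> makes the scan
  pass every window of \<open>X\<close>, and the distance condition below \<open>bar b\<close> makes
  it stop there. Excluding residue 1 in \<open>X\<close> makes the comparison strict, as the scan
  tests it.\<close>

lemma insert_bar_advance:
  assumes "valid (advance X @ bar b # Y)" "\<forall>x\<in>set X. x mod H \<noteq> 1"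
  shows "insert_bar (b + int (count X)) (X @ Y) = advance X @ bar b # Y"
  using assms
proof (induction X rule: window_induct)
  case Nil
  then have v: "valid (bar b # Y)" by simp
  show ?case
  proof (cases "tight Y")
    case True
    then have "\<not> above (Y ! (w - 1) + H) (bar b)" using v by (simp add: valid_Cons tight_def)
    then have "Y ! (w - 1) \<le> bar (b - 1)" by (auto simp: bar_pred above_def)
    then show ?thesis using True by (simp add: insert_bar_stop)
  next
    case False
    have "Y = [] \<or> above (bar b) (hd Y)" using v by (cases Y) (auto simp: valid_Cons)
    then have "Y = [] \<or> hd Y < bar b" by (auto simp: above_def)
    then show ?thesis using False by (simp add: insert_bar_stop)
  qed
next
  case (window V x Z)
  have v: "valid (((x + H) # V) @ advance Z @ bar b # Y)" using window by (simp add: advance_window)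
  then have "valid (advance Z @ bar b # Y)" using valid_appendD by blast
  then have IH: "insert_bar (b + int (count Z)) (Z @ Y) = advance Z @ bar b # Y" using window by simp
  have "bar b + H * int (count (V @ x # Z)) \<le> x + H"
    using advance_hd_bound[OF window.prems(1)] window.hyps by (simp add: advance_window)
  then have "bar (b + int (count (V @ x # Z)) - 1) \<le> x"
    by (simp add: bar_def algebra_simps)
  moreover have "x mod H \<noteq> 1" using window.prems(2) by simp
  then have "x \<noteq> bar (b + int (count (V @ x # Z)) - 1)" by (metis bar_mod)
  ultimately have "bar (b + int (count (V @ x # Z)) - 1) < x" by linarith
  then show ?case using insert_bar_window[of V x "Z @ Y" "b + int (count (V @ x # Z))"] IH window.hyps
    by (simp add: advance_window count_window tight_window_append)
next
  case (skip h Z)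
  have v: "valid (h # advance Z @ bar b # Y)" using skip by (simp add: advance_Cons)
  have "\<not> tight (h # Z @ Y)" by (rule deleted_head_not_tight[OF skip.hyps(1) v])
  moreover have "bar (b + int (count Z)) \<le> h"
    using advance_hd_bound[OF skip.prems(1)] skip.hyps
    by (simp add: advance_Cons count_Cons bar_def algebra_simps)
  ultimately show ?case using skip v by (simp add: insert_bar_skip advance_Cons count_Cons valid_Cons)
qed

text \<open>Since \<open>z\<close> fits between the advanced \<open>X\<close> and the rest, the scan
  takes no window across the place of \<open>z\<close>.\<close>

lemma count_append_advance:
  assumes "valid (advance X @ z # Y @ Y')"
  shows "count (X @ Y) = count X + count Y"
  using assms
proof (induction X rule: window_induct)
  case (window V x Z)
  have "valid (((x + H) # V) @ advance Z @ z # Y @ Y')" using window by (simp add: advance_window)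
  then have "valid (advance Z @ z # Y @ Y')" using valid_appendD by blast
  then show ?case using window by (simp add: count_window tight_window_append)
next
  case (skip h Z)
  have v: "valid (h # advance Z @ z # Y @ Y')" using skip by (simp add: advance_Cons)
  have "\<not> tight (h # Z @ Y)"
    using deleted_head_not_tight[OF skip.hyps(1) v] tight_appendI[of "h # Z @ Y" Y'] by auto
  then show ?case using skip v by (simp add: count_Cons valid_Cons)
qed simp

section \<open>Parities of tight windows\<close>

text \<open>Condition (5) brought to one side. The overlined parts up to the head of a window are
  those from the head to the end of the list, so the whole of \<open>xs\<close> is counted although
  only its first \<open>w\<close> parts are summed.\<close>

definition parity :: "int list \<Rightarrow> int" where
  "parity xs = (\<Sum>x\<leftarrow>take w xs. x div H) - int (length (filter odd xs))"

text \<open>All that is used of the moduli: without overlined multiples the odd codes have at most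
  as many residues as there are moduli, hence at most \<open>w\<close>.\<close>

definition regular :: "int list \<Rightarrow> bool" where
  "regular xs \<longleftrightarrow> (\<forall>x\<in>set xs. even x \<longrightarrow> H dvd x) \<and>
     card ((\<lambda>x. x mod H) ` {x \<in> set xs. odd x}) \<le> w"

lemma parity_step:
  assumes "w \<le> length ys"
  shows "parity (x # ys) - parity ys = x div H - ys ! (w - 1) div H - of_bool (odd x)"
proof -
  have t1: "take w (x # ys) = x # take (w - 1) ys" using w_pos by (cases w) auto
  have t2: "take w ys = take (w - 1) ys @ [ys ! (w - 1)]"
    using take_Suc_conv_app_nth[of "w - 1" ys] assms w_pos by simp
  show ?thesis unfolding parity_def t1 t2 by simp
qed

lemma parity_move:
  assumes "length V = w - 1"
  shows "parity ((x + H) # V @ Y) = parity (V @ x # Y) + 1"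
proof -
  have t: "take w ((x + H) # V @ Y) = (x + H) # V" "take w (V @ x # Y) = V @ [x]"
    using assms w_pos by (auto simp: take_Cons')
  have "(x + H) div H = x div H + 1" using H_pos by (simp add: div_add_self2)
  then show ?thesis using H_even unfolding parity_def t by simp
qed

lemma block_bounds: "x div H * H \<le> x" "x < (x div H + 1) * H"
proof -
  have "x = x div H * H + x mod H" "(x div H + 1) * H = x div H * H + H"
    by (simp_all add: distrib_right)
  then show "x div H * H \<le> x" "x < (x div H + 1) * H"
    using pos_mod_bound[OF H_pos, of x] pos_mod_sign[OF H_pos, of x] by linarith+
qed

lemma block_div: "q * H \<le> x \<Longrightarrow> x < (q + 1) * H \<Longrightarrow> x div H = q"
  by (rule int_div_pos_eq[of x H q "x - q * H"]) (auto simp: algebra_simps)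

lemma parity_diff:
  assumes "i \<le> j" "j + w \<le> length xs"
    and "\<And>t. i \<le> t \<Longrightarrow> t < j \<Longrightarrow> even (xs ! t div H - xs ! (t + w) div H - of_bool (odd (xs ! t)))"
  shows "even (parity (drop i xs) - parity (drop j xs))"
  using assms
proof (induction j rule: dec_induct)
  case (step n)
  have "drop n xs = xs ! n # drop (Suc n) xs" using step by (simp add: Cons_nth_drop_Suc)
  then have "parity (drop n xs) - parity (drop (Suc n) xs) =
      xs ! n div H - xs ! (n + w) div H - of_bool (odd (xs ! n))"
    using parity_step[of "drop (Suc n) xs" "xs ! n"] step w_pos by (simp add: add.commute)
  moreover have "even (xs ! n div H - xs ! (n + w) div H - of_bool (odd (xs ! n)))"
    by (rule step.prems(2)) (use step in auto)
  moreover have "even (parity (drop i xs) - parity (drop n xs))" using step by simp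
  ultimately have "even ((parity (drop i xs) - parity (drop n xs)) +
      (parity (drop n xs) - parity (drop (Suc n) xs)))" by (simp only: dvd_add)
  then show ?case by simp
qed simp

text \<open>An overlined \<open>x\<close> lies one block above \<open>y\<close> and is counted once
  as overlined; a non-overlined \<open>x\<close> must be the multiple of \<open>H\<close> two blocks
  above. Either way the term is even.\<close>

lemma block_term_even:
  assumes "even x \<longrightarrow> H dvd x" "(y div H + 1) * H < x" "x \<le> (y div H + 2) * H"
  shows "even (x div H - y div H - of_bool (odd x))"
proof (cases "even x")
  case True
  then obtain q where q: "x = q * H" using assms(1) by (auto simp: dvd_def mult.commute)
  then have "y div H + 1 < q" "q \<le> y div H + 2" using assms(2,3) H_pos by simp_all
  then have "q = y div H + 2" by simp
  then show ?thesis using q H_pos True by simp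
next
  case False
  then have "x \<noteq> (y div H + 2) * H" using H_even by auto
  then have "x < (y div H + 1 + 1) * H" using assms(3) by (simp add: algebra_simps)
  then have "x div H = y div H + 1" using assms(2) by (intro block_div) auto
  then show ?thesis using False by simp
qed

lemma above_odd: "above x y \<Longrightarrow> odd x \<or> odd y \<Longrightarrow> y < x"
  by (auto simp: above_def)

lemma not_between_multiples: "H dvd x \<Longrightarrow> q * H < x \<Longrightarrow> x < (q + 1) * H \<Longrightarrow> False"
proof (elim dvdE)
  fix k assume "q * H < x" "x < (q + 1) * H" "x = H * k"
  then have "q * H < k * H" "k * H < (q + 1) * H" by (simp_all add: mult.commute)
  then show False using mult_less_cancel_right_pos[OF H_pos] by fastforce
qed

lemma mod_inject_block:
  assumes "q * H < x" "x < (q + 1) * H" "q * H < y" "y < (q + 1) * H" "x mod H = y mod H"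
  shows "x = y"
proof -
  have "x div H = q" "y div H = q"
    using assms by (auto intro!: block_div)
  then show ?thesis using assms(5) by (metis div_mult_mod_eq)
qed

text \<open>Since the windows leave room for all residues, no two of them can interlock in such a way that
  the bound \<open>x \<le> (y div H + 2) * H\<close> fails: that would exhibit \<open>w + 1\<close> distinct residues.\<close>

lemma block_upper_bound:
  assumes v: "valid xs" and r: "regular xs" and ij: "i \<le> j" "j \<le> i + w"
    and ti: "tight (drop i xs)" and tj: "tight (drop j xs)"
    and zv: "above (xs ! (j + w - 1) + 2 * H) (xs ! i)" and t: "i \<le> t" "t < j"
  shows "xs ! t \<le> (xs ! (t + w) div H + 2) * H"
proof (rule ccontr)
  define z where "z = xs ! (j + w - 1)"
  define c where "c = z div H"
  have len: "j + w \<le> length xs" "i + w \<le> length xs" using ti tj tight_drop by auto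
  have mono: "xs ! q \<le> xs ! p" if "p \<le> q" "q < length xs" for p q
    using valid_nth_above[OF v, of p q] that by (cases "p = q") (auto simp: above_def)
  have strict: "xs ! q < xs ! p" if "p < q" "q < length xs" "odd (xs ! q)" for p q
    using valid_nth_above[OF v, of p q] that by (auto simp: above_def)
  have dv: "H dvd xs ! p" if "p < length xs" "even (xs ! p)" for p
    using r that nth_mem[OF that(1)] unfolding regular_def by blast
  assume "\<not> ?thesis"
  then have up: "(xs ! (t + w) div H + 2) * H < xs ! t" by simp
  have zb: "c * H \<le> z" "z < (c + 1) * H"
    unfolding c_def by (rule block_bounds)+
  have yz: "z \<le> xs ! (t + w)" unfolding z_def by (rule mono) (use t len w_pos in auto)
  then have cy: "c \<le> xs ! (t + w) div H" unfolding c_def using H_pos by (simp add: zdiv_mono1)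
  have xi: "xs ! t \<le> xs ! i" by (rule mono) (use t len w_pos in auto)
  have vz: "xs ! i \<le> z + 2 * H" "odd z \<Longrightarrow> xs ! i < z + 2 * H"
    using zv by (auto simp: above_def z_def)
  have "\<not> c + 1 \<le> xs ! (t + w) div H"
  proof
    assume "c + 1 \<le> xs ! (t + w) div H"
    then have "(c + 1 + 2) * H \<le> (xs ! (t + w) div H + 2) * H" using H_pos by simp
    then show False using up xi vz(1) zb(2) by (simp add: algebra_simps)
  qed
  then have yc: "xs ! (t + w) div H = c" using cy by simp
  have "z \<noteq> c * H"
  proof
    assume "z = c * H"
    then show False using up xi vz(1) yc by (simp add: algebra_simps)
  qed
  then have zb1: "c * H < z" using zb(1) by simp
  have zodd: "odd z"
  proof
    assume "even z"
    then have "H dvd z" using dv[of "j + w - 1"] len w_pos unfolding z_def by simp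
    then show False using not_between_multiples zb1 zb(2) by blast
  qed
  have ytop: "xs ! (t + w) < (c + 1) * H"
    using block_bounds(2)[of "xs ! (t + w)"] yc by simp
  have odd_in: "odd (xs ! p)" if "p < length xs" "q * H < xs ! p" "xs ! p < (q + 1) * H" for p q
    using dv that not_between_multiples by blast
  \<comment> \<open>\<open>?O\<close> is the overlap of the two windows, \<open>?A\<close> lies in
    the first and \<open>?C\<close> in the second, \<open>w + 1\<close> places in all. Subtracting
    \<open>2 * H\<close>, \<open>H\<close> and \<open>0\<close> brings their parts into the block of
    \<open>z\<close>: those of \<open>?A\<close> up to \<open>xs ! i - 2 * H\<close>, those of
    \<open>?O\<close> between that and \<open>z\<close>, those of \<open>?C\<close> from
    \<open>z\<close> on.\<close>
  let ?A = "{i..t}" and ?O = "{j..<i + w}" and ?C = "{t + w..<j + w}"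
  define g where "g p = (if p \<le> t then xs ! p - 2 * H else if p < t + w then xs ! p - H else xs ! p)" for p
  have gA: "c * H < g p" "g p < z" "g p \<le> xs ! i - 2 * H" "odd (xs ! p)" if "p \<in> ?A" for p
  proof -
    have 1: "xs ! t \<le> xs ! p" "xs ! p \<le> xs ! i" using that t len by (auto intro!: mono)
    then have 2: "(c + 2) * H < xs ! p" "xs ! p < z + 2 * H" using up yc vz(2) zodd by auto
    then show "c * H < g p" "g p < z" "g p \<le> xs ! i - 2 * H" using that 1 by (auto simp: g_def algebra_simps)
    show "odd (xs ! p)" by (rule odd_in[of p "c + 2"]) (use 2 zb that t len in \<open>auto simp: algebra_simps\<close>)
  qed
  have vodd: "odd (xs ! i)" "(c + 2) * H < xs ! i" using gA(4)[of i] t up yc xi by auto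
  have gO: "xs ! i - 2 * H < g p" "g p < z" "odd (xs ! p)" if "p \<in> ?O" for p
  proof -
    have "above (xs ! (i + w - 1) + H) (xs ! i)" "above (z + H) (xs ! j)"
      using ti tj unfolding tight_drop z_def by auto
    moreover have "odd (z + H)" using zodd H_even by simp
    ultimately have "xs ! i < xs ! (i + w - 1) + H" "xs ! j < z + H"
      using vodd(1) above_odd by blast+
    moreover have "xs ! (i + w - 1) \<le> xs ! p" "xs ! p \<le> xs ! j" using that len by (auto intro!: mono)
    ultimately have 1: "xs ! i - H < xs ! p" "xs ! p < z + H" by auto
    show "xs ! i - 2 * H < g p" "g p < z" using that 1 t by (auto simp: g_def)
    show "odd (xs ! p)"
      by (rule odd_in[of p "c + 1"]) (use 1 zb vodd(2) that len in \<open>auto simp: algebra_simps\<close>)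
  qed
  have gC: "z \<le> g p" "g p < (c + 1) * H" "odd (xs ! p)" if "p \<in> ?C" for p
  proof -
    have 1: "xs ! p \<le> xs ! (t + w)" "z \<le> xs ! p" unfolding z_def using that len by (auto intro!: mono)
    then show "z \<le> g p" "g p < (c + 1) * H" using that ytop w_pos by (auto simp: g_def)
    show "odd (xs ! p)"
      by (rule odd_in[of p c]) (use 1 ytop zb1 that len in \<open>auto simp: algebra_simps\<close>)
  qed
  let ?I = "?A \<union> ?O \<union> ?C"
  have gI: "c * H < g p" "g p < (c + 1) * H" "odd (xs ! p)" "p < length xs" if "p \<in> ?I" for p
    using that gA[of p] gO[of p] gC[of p] zb zb1 vodd(2) t len by (auto simp: algebra_simps)
  have gmod: "g p mod H = xs ! p mod H" for p
    using mod_mult_self1[of "xs ! p - 2 * H" 2 H] by (simp add: g_def)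
  have gneq: "g p \<noteq> g q" if pq: "p \<in> ?I" "q \<in> ?I" "p < q" for p q
  proof -
    have s: "xs ! q < xs ! p" using strict gI pq by blast
    consider "q \<in> ?A" | "p \<in> ?A" "q \<in> ?O" | "p \<in> ?O" "q \<in> ?O" | "p \<in> ?A \<union> ?O" "q \<in> ?C" | "p \<in> ?C"
      using pq t by auto
    then show ?thesis
    proof cases
      case 1
      then show ?thesis using s pq by (auto simp: g_def)
    next
      case 2
      then show ?thesis using gA[of p] gO[of q] by auto
    next
      case 3
      then show ?thesis using s t by (auto simp: g_def)
    next
      case 4
      then show ?thesis using gA[of p] gO[of p] gC[of q] by auto
    next
      case 5
      then show ?thesis using s pq w_pos by (auto simp: g_def)
    qed
  qed
  have "inj_on (\<lambda>p. xs ! p mod H) ?I"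
  proof (rule inj_onI)
    fix p q assume p: "p \<in> ?I" and q: "q \<in> ?I" and e: "xs ! p mod H = xs ! q mod H"
    have "g p = g q"
      by (rule mod_inject_block) (use gI p q e gmod in auto)
    then show "p = q" using gneq[OF p q] gneq[OF q p] by (metis linorder_neqE_nat)
  qed
  then have "card ?I = card ((\<lambda>p. xs ! p mod H) ` ?I)" by (simp add: card_image)
  also have "\<dots> \<le> card ((\<lambda>x. x mod H) ` {x \<in> set xs. odd x})"
  proof (rule card_mono)
    show "(\<lambda>p. xs ! p mod H) ` ?I \<subseteq> (\<lambda>x. x mod H) ` {x \<in> set xs. odd x}"
      using gI(3,4) by (intro image_subsetI imageI) auto
  qed simp
  also have "\<dots> \<le> w" using r by (simp add: regular_def)
  finally have "card ?I \<le> w" .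
  moreover have "card ?I = w + 1"
  proof -
    have "?A \<inter> ?O = {}" "(?A \<union> ?O) \<inter> ?C = {}" using t w_pos by auto
    then have "card ?I = (card ?A + card ?O) + card ?C" by (simp add: card_Un_disjoint)
    then show ?thesis using t ij by simp
  qed
  ultimately show False by simp
qed

text \<open>Shifting the window from \<open>i\<close> to \<open>j\<close> one place at a time
  changes the parity by even amounts. The distance condition bounds each entering part from above;
  the span \<open>2 * H\<close> bounds the leaving one. Adjacent windows, \<open>j = i + w\<close>,
  are included.\<close>

lemma parity_eq:
  assumes v: "valid xs" and r: "regular xs" and ij: "i \<le> j" "j \<le> i + w"
    and ti: "tight (drop i xs)" and tj: "tight (drop j xs)"
    and zv: "above (xs ! (j + w - 1) + 2 * H) (xs ! i)"
  shows "even (parity (drop i xs) - parity (drop j xs))"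
proof (rule parity_diff[OF ij(1)])
  show len: "j + w \<le> length xs" using tj tight_drop by auto
  fix t assume t: "i \<le> t" "t < j"
  have ev: "even (xs ! t) \<longrightarrow> H dvd xs ! t" using r t len unfolding regular_def by auto
  let ?y = "xs ! (t + w)"
  have "\<not> above (?y + H) (xs ! t)" using valid_far[OF v, of t "t + w"] t len by simp
  then have x: "?y + H \<le> xs ! t" "even (xs ! t) \<Longrightarrow> ?y + H < xs ! t"
    by (cases "?y + H = xs ! t"; auto simp: above_def)+
  have y: "?y div H * H \<le> ?y" by (rule block_bounds)
  have "(?y div H + 1) * H \<noteq> xs ! t"
  proof
    assume e: "(?y div H + 1) * H = xs ! t"
    then have "even (xs ! t)" using H_even by (metis dvd_mult)
    then show False using x(2) y e by (simp add: algebra_simps)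
  qed
  then have "(?y div H + 1) * H < xs ! t" using x(1) y by (simp add: algebra_simps)
  then show "even (xs ! t div H - ?y div H - of_bool (odd (xs ! t)))"
    using block_term_even ev block_upper_bound[OF assms t] by blast
qed

text \<open>Overlapping windows share a part, so together they span at most
  \<open>2 * H\<close>.\<close>

lemma parity_overlap:
  assumes "valid xs" "regular xs" "i \<le> j" "j < i + w" "tight (drop i xs)" "tight (drop j xs)"
  shows "even (parity (drop i xs) - parity (drop j xs))"
proof (rule parity_eq[OF assms(1-3) _ assms(5,6)])
  have a: "above (xs ! (i + w - 1) + H) (xs ! i)" "above (xs ! (j + w - 1) + H) (xs ! j)" "j + w \<le> length xs"
    using assms(5,6) unfolding tight_drop by auto
  have "above (xs ! (j + w - 1) + 2 * H) (xs ! j + H)"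
    using a(2) above_add[of "xs ! (j + w - 1) + H" "xs ! j"] by (simp add: algebra_simps)
  moreover have "j = i + w - 1 \<or> above (xs ! j + H) (xs ! (i + w - 1) + H)"
    using valid_nth_above[OF assms(1), of j "i + w - 1"] assms(3,4) a(3) by fastforce
  ultimately show "above (xs ! (j + w - 1) + 2 * H) (xs ! i)" using a(1) above_trans by metis
qed (use assms in simp)

section \<open>Growing and shrinking configurations\<close>

function advance_first :: "nat \<Rightarrow> int list \<Rightarrow> int list" where
  "advance_first d xs = (if d = 0 \<or> xs = [] then xs
     else if tight xs then (xs ! (w - 1) + H) # take (w - 1) xs @ advance_first (d - 1) (drop w xs)
     else hd xs # advance_first d (tl xs))"
  by auto
termination
  by (relation "measure (length \<circ> snd)") (use w_pos in auto)

declare advance_first.simps [simp del]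

lemma advance_first_0 [simp]: "advance_first 0 xs = xs"
  by (simp add: advance_first.simps)

lemma advance_first_count: "advance_first (count X) (X @ Y) = advance X @ Y"
proof (induction X rule: window_induct)
  case (window V x Z)
  have "tight (V @ x # Z @ Y)" using window tight_window_append by simp
  then show ?case using window w_pos
    by (simp add: advance_first.simps[of "Suc _" "V @ x # Z @ Y"] advance_window count_window nth_append)
next
  case (skip h Z)
  show ?case
  proof (cases "count Z = 0")
    \<comment> \<open>Nothing is left to advance, so \<open>advance_first\<close> stops at once,
      even if \<open>h # Z @ Y\<close> is tight.\<close>
    case True
    then show ?thesis using skip by (simp add: count_Cons advance_Cons count_0_advance)
  next
    case False
    then have "w \<le> length (h # Z)" using count_short[of Z] by fastforce
    then have "\<not> tight (h # Z @ Y)" using tight_prefix[of "h # Z" Y] skip.hyps by simp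
    then show ?thesis using skip
      by (simp add: count_Cons advance_Cons advance_first.simps[of _ "h # Z @ Y"] count_0_advance)
  qed
qed simp

lemma count_snoc_le: "count (xs @ [x]) \<le> Suc (count xs)"
  using count_drop[of 1 "- x # neg xs"] count_neg[of "xs @ [x]"] count_neg[of xs] w_pos by simp

text \<open>A discrete intermediate value argument: appending one part raises \<open>count\<close>
  by at most one.\<close>

lemma count_prefix:
  assumes "d \<le> count xs"
  obtains X Y where "xs = X @ Y" "count X = d"
proof -
  have "\<exists>X Y. xs = X @ Y \<and> count X = d" using assms
  proof (induction xs rule: rev_induct)
    case (snoc x xs)
    show ?case
    proof (cases "d \<le> count xs")
      case True
      then show ?thesis using snoc by fastforce
    next
      case False
      then have "d = count (xs @ [x])" using snoc count_snoc_le[of xs x] by linarith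
      then show ?thesis by (intro exI[of _ "xs @ [x]"] exI[of _ "[]"]) simp
    qed
  qed simp
  then show ?thesis using that by blast
qed

lemma prefix_window:
  assumes "0 < d" "d \<le> count xs"
  obtains X V x Y where "xs = X @ V @ x # Y" "length V = w - 1" "tight (V @ [x])"
    "count (X @ V @ [x]) = d" "advance (X @ V @ [x]) = advance X @ (x + H) # V"
proof -
  obtain X1 Y1 where 1: "xs = X1 @ Y1" "count X1 = d" using count_prefix assms(2) by blast
  then obtain X V x Y where *: "X1 = X @ V @ x # Y" "length V = w - 1" "tight (V @ [x])"
    "count X1 = Suc (count X)" "advance (X @ V @ [x]) = advance X @ (x + H) # V"
    "count (X @ V @ [x]) = Suc (count X)"
    using last_window[of X1] assms(1) by metis
  show ?thesis by (rule that[of X V x "Y @ Y1"]) (use 1 * in auto)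
qed

lemma count_take_mono: "n \<le> l \<Longrightarrow> count (take n xs) \<le> count (take l xs)"
  using count_append_le[of "take n xs" "drop n (take l xs)"]
  by (metis add_leD1 append_take_drop_id min.absorb1 take_take)

lemma retreat_window:
  assumes "length V = w - 1" "tight (u # V)"
  shows "retreat (X @ u # V) = retreat X @ V @ [u - H]"
proof -
  have l: "length (u # V) = w" using assms(1) w_pos by simp
  then have "tight (neg V @ [- u])" using tight_neg[OF l] assms(2) by simp
  then have "tight (neg V @ (- u) # neg X)" using tight_window[of "neg V"] assms(1) by simp
  then have "advance (neg V @ (- u) # neg X) = (- u + H) # neg V @ advance (neg X)"
    by (rule advance_window[rotated]) (use assms in simp)
  then show ?thesis by (simp add: retreat_def)
qed

lemma retreat_props:
  assumes "y \<in> set (retreat xs)"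
  shows "y \<in> set xs \<or> y + H \<in> set xs"
proof -
  have "- y \<in> set (advance (neg xs))" using assms by (auto simp: retreat_def set_neg)
  then have "- y \<in> set (neg xs) \<or> - y - H \<in> set (neg xs)" using advance_props by blast
  then obtain x where "x \<in> set xs" "- y = - x \<or> - y - H = - x" by (auto simp: set_neg)
  moreover from this(2) have "x = y \<or> x = y + H" by linarith
  ultimately show ?thesis by blast
qed

end

text \<open>\<open>P\<close> consists of phantom parts below all real ones. They turn conditions at
  the lower end into distance conditions, \<open>last_P\<close> keeps retreated parts positive, and
  \<open>parity_P\<close> gives the phantom window the right parity, so that wrong windows stay
  clear of it.\<close>

locale bar_insertion = windows +
  fixes P :: "int list" and ref :: int and Rs :: "int set"
  assumes length_P: "length P = w" and P_mult: "\<forall>x\<in>set P. x \<le> 0 \<and> H dvd x"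
    and last_P: "- H \<le> last P" and tight_P: "tight P" and parity_P: "even (parity P - ref)"
    and finite_Rs: "finite Rs" and card_Rs: "card Rs \<le> w"
begin

text \<open>The bound \<open>1 < x\<close> excludes both codes of size zero; residue 1 belongs to
  the overlined multiples.\<close>

definition part_code :: "int \<Rightarrow> bool" where
  "part_code x \<longleftrightarrow> 1 < x \<and> (even x \<longrightarrow> H dvd x) \<and> (odd x \<longrightarrow> x mod H \<in> insert 1 Rs)"

definition config :: "int list \<Rightarrow> bool" where
  "config c \<longleftrightarrow> valid c \<and> (\<exists>a. c = a @ P \<and> (\<forall>x\<in>set a. part_code x))"

definition barred :: "int list \<Rightarrow> bool" where
  "barred c \<longleftrightarrow> (\<exists>x\<in>set c. x mod H = 1)"

definition wrong :: "int list \<Rightarrow> bool" where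
  "wrong c \<longleftrightarrow> tight c \<and> odd (parity c - ref)"

definition lowest :: "int list \<Rightarrow> nat" where
  "lowest c = (GREATEST i. wrong (drop i c))"

definition upper :: "int list \<Rightarrow> int list" where
  "upper c = takeWhile (\<lambda>x. x mod H \<noteq> 1) c"

definition lower :: "int list \<Rightarrow> int list" where
  "lower c = dropWhile (\<lambda>x. x mod H \<noteq> 1) c"

text \<open>The size inserted last, read off the result: the topmost overlined multiple plus one for
  each window above it, or the number of windows down to the lowest wrong one. The default 0 means
  that nothing was inserted.\<close>

definition top_size :: "int list \<Rightarrow> int" where
  "top_size c = (if barred c then hd (lower c) div H + int (count (upper c))
     else if \<exists>i. wrong (drop i c) then int (count (take (lowest c + w) c)) else 0)"

text \<open>The filter removes the phantom parts, whose windows must not be counted.\<close>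

definition grow :: "int \<Rightarrow> int list \<Rightarrow> int list" where
  "grow d c = (if barred c \<or> int (count (filter (\<lambda>x. 0 < x) c)) < d then insert_bar d c
     else advance_first (nat d) c)"

definition shrink :: "int list \<Rightarrow> int list" where
  "shrink c = (if barred c then retreat (upper c) @ tl (lower c)
     else retreat (take (lowest c + w) c) @ drop (lowest c + w) c)"

definition wt :: "int list \<Rightarrow> int" where
  "wt c = (\<Sum>x\<leftarrow>c. x div 2)"

lemma H_ge2: "2 \<le> H"
  using H_pos H_even by (cases "H = 1") auto

lemma P_not_bar: "x \<in> set P \<Longrightarrow> x mod H \<noteq> 1"
  using P_mult by auto

lemma P_nonempty: "P \<noteq> []"
  using length_P w_pos by auto

lemma part_code_shift: "part_code x \<Longrightarrow> part_code (x + H)"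
  using H_pos H_even by (auto simp: part_code_def)

lemma part_code_advance: "\<forall>x\<in>set X. part_code x \<Longrightarrow> \<forall>x\<in>set (advance X). part_code x"
  using advance_props[of X] part_code_shift by (metis diff_add_cancel)

lemma not_bar_advance: "\<forall>x\<in>set X. x mod H \<noteq> 1 \<Longrightarrow> \<forall>x\<in>set (advance X). x mod H \<noteq> 1"
  using advance_props[of X] by (metis minus_mod_self2)

lemma not_bar_retreat: "\<forall>x\<in>set X. x mod H \<noteq> 1 \<Longrightarrow> \<forall>x\<in>set (retreat X). x mod H \<noteq> 1"
  using retreat_props[of _ X] by (metis mod_add_self2)

lemma wt_advance: "wt (advance X @ Y) = wt (X @ Y) + (H div 2) * int (count X)"
  using advance_props[of X] by (simp add: wt_def)

lemma body_eq: "\<forall>x\<in>set a. part_code x \<Longrightarrow> filter (\<lambda>x. 0 < x) (a @ P) = a"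
  using P_mult by (auto simp: part_code_def filter_empty_conv not_less intro!: filter_True)

text \<open>The last phantom part is at least \<open>w\<close> places below \<open>y\<close> and not
  less than \<open>- H\<close>, so \<open>y\<close> cannot be negative. The value 0 would need
  equality, which the distance condition allows only for odd codes.\<close>

lemma above_tail:
  assumes v: "valid (a @ P)" and y: "y \<in> set a" "even y \<longrightarrow> H dvd y" "y mod H \<noteq> 1"
  shows "1 < y"
proof -
  obtain t where t: "t < length a" "y = a ! t" using y(1) by (metis in_set_conv_nth)
  have "\<not> above ((a @ P) ! (length a + w - 1) + H) ((a @ P) ! t)"
    by (rule valid_far[OF v]) (use t length_P w_pos in auto)
  moreover have "(a @ P) ! (length a + w - 1) = last P"
    unfolding length_P[symmetric] using P_nonempty by (cases P) (auto simp: nth_append last_conv_nth)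
  ultimately have far: "\<not> above (last P + H) y" using t by (simp add: nth_append)
  have "y \<noteq> 1" using y(3) H_ge2 by auto
  have f: "last P + H \<le> y" "last P + H = y \<Longrightarrow> odd y"
    using far unfolding above_def by (simp, metis)
  then have "0 \<le> y" using last_P by linarith
  moreover have "y \<noteq> 0"
  proof
    assume "y = 0"
    then have "last P + H = y" using f(1) last_P by linarith
    then show False using f(2) \<open>y = 0\<close> by simp
  qed
  ultimately show ?thesis using \<open>y \<noteq> 1\<close> by linarith
qed

lemma config_regular:
  assumes c: "config c" and nb: "\<not> barred c"
  shows "regular c"
proof -
  obtain a where a: "c = a @ P" "\<forall>x\<in>set a. part_code x" using c by (auto simp: config_def)
  have "(\<lambda>x. x mod H) ` {x \<in> set c. odd x} \<subseteq> Rs"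
    using a nb P_mult H_even by (auto simp: part_code_def barred_def dest: dvd_trans)
  then have "card ((\<lambda>x. x mod H) ` {x \<in> set c. odd x}) \<le> w"
    using card_mono[OF finite_Rs] card_Rs order_trans by blast
  then show ?thesis using a P_mult by (auto simp: regular_def part_code_def)
qed

lemma wrong_le: "wrong (drop i c) \<Longrightarrow> i \<le> length c"
  unfolding wrong_def tight_drop by simp

lemma lowest_wrong:
  assumes "wrong (drop i c)"
  shows "wrong (drop (lowest c) c)" "i \<le> lowest c"
proof -
  have b: "\<And>y. wrong (drop y c) \<Longrightarrow> y \<le> length c" by (rule wrong_le)
  show "wrong (drop (lowest c) c)" unfolding lowest_def
    using GreatestI_nat[of "\<lambda>i. wrong (drop i c)" i "length c"] assms b by blast
  show "i \<le> lowest c" unfolding lowest_def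
    using Greatest_le_nat[of "\<lambda>i. wrong (drop i c)" i "length c"] assms b by blast
qed

lemma lowest_eqI:
  "wrong (drop i c) \<Longrightarrow> (\<And>j. i < j \<Longrightarrow> \<not> wrong (drop j c)) \<Longrightarrow> lowest c = i"
  unfolding lowest_def by (rule Greatest_equality) (auto simp: not_less[symmetric])

text \<open>A wrong window reaching into the phantom parts would overlap the phantom window, whose
  parity is right.\<close>

lemma wrong_in_body:
  assumes c: "valid (a @ P)" "regular (a @ P)" and i: "wrong (drop i (a @ P))"
  shows "i + w \<le> length a"
proof (rule ccontr)
  assume n: "\<not> ?thesis"
  have t: "tight (drop i (a @ P))" "i + w \<le> length (a @ P)"
    using i unfolding wrong_def tight_drop by auto
  then have "i \<le> length a" using length_P by simp
  moreover have "tight (drop (length a) (a @ P))" using tight_P by simp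
  ultimately have "even (parity (drop i (a @ P)) - parity (drop (length a) (a @ P)))"
    using parity_overlap[OF c(1,2), of i "length a"] t(1) n by simp
  then show False using i parity_P unfolding wrong_def by simp
qed

lemma count_wrong_pos: "wrong (drop i c) \<Longrightarrow> 0 < count (take (i + w) c)"
proof -
  assume "wrong (drop i c)"
  then have t: "tight (take w (drop i c))" "take w (drop i c) \<noteq> []"
    using tight_take[of "drop i c"] w_pos by (auto simp: wrong_def tight_def)
  then have "0 < count (take w (drop i c))" by (simp add: count.simps[of "take w _"])
  then show ?thesis using count_append_le[of "take i c" "take w (drop i c)"] by (simp add: take_add)
qed

lemma top_size_barred:
  assumes "\<forall>x\<in>set X. x mod H \<noteq> 1"
  shows "barred (X @ bar b # Y)" "upper (X @ bar b # Y) = X" "lower (X @ bar b # Y) = bar b # Y"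
    "top_size (X @ bar b # Y) = b + int (count X)"
proof -
  show 1: "barred (X @ bar b # Y)" "upper (X @ bar b # Y) = X" "lower (X @ bar b # Y) = bar b # Y"
    using assms bar_mod by (auto simp: barred_def upper_def lower_def)
  have "bar b div H = b" using H_ge2 by (simp add: bar_def)
  then show "top_size (X @ bar b # Y) = b + int (count X)" by (simp add: top_size_def 1)
qed

lemma barred_split:
  assumes c: "valid (a @ P)" "\<forall>x\<in>set a. part_code x" and b: "barred (a @ P)"
  obtains X b Y where "a = X @ bar b # Y" "\<forall>x\<in>set X. x mod H \<noteq> 1" "1 \<le> b"
proof -
  have "\<exists>x\<in>set a. x mod H = 1" using b P_not_bar by (auto simp: barred_def)
  then obtain X z Y where a: "a = X @ z # Y" "z mod H = 1" "\<forall>x\<in>set X. x mod H \<noteq> 1"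
    using split_list_first_prop[of a "\<lambda>x. x mod H = 1"] by blast
  have z: "z = bar (z div H)" using a(2) div_mult_mod_eq[of z H] by (simp add: bar_def)
  have "1 < z" using c(2) a(1) by (simp add: part_code_def)
  then have "0 < z div H * H" using z by (simp add: bar_def)
  then have "1 \<le> z div H" using H_pos by (simp add: zero_less_mult_iff)
  then show ?thesis using that[of X "z div H" Y] a z by simp
qed

lemma top_size_0:
  assumes "config c"
  shows "0 \<le> top_size c" "top_size c = 0 \<longleftrightarrow> \<not> barred c \<and> (\<forall>i. \<not> wrong (drop i c))"
proof -
  obtain a where a: "c = a @ P" "\<forall>x\<in>set a. part_code x" "valid (a @ P)"
    using assms by (auto simp: config_def)
  have "0 \<le> top_size c \<and> (top_size c = 0 \<longleftrightarrow> \<not> barred c \<and> (\<forall>i. \<not> wrong (drop i c)))"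
  proof (cases "barred c")
    case True
    then obtain X b Y where X: "a = X @ bar b # Y" "\<forall>x\<in>set X. x mod H \<noteq> 1" "1 \<le> b"
      using barred_split a by metis
    then have "top_size c = b + int (count X)"
      using top_size_barred[of X b "Y @ P"] a(1) by simp
    then show ?thesis using True X(3) by simp
  next
    case False
    have "0 < count (take (lowest c + w) c)" if "wrong (drop i c)" for i
      using count_wrong_pos lowest_wrong(1)[OF that] by blast
    then show ?thesis using False by (auto simp: top_size_def)
  qed
  then show "0 \<le> top_size c" "top_size c = 0 \<longleftrightarrow> \<not> barred c \<and> (\<forall>i. \<not> wrong (drop i c))" by auto
qed

text \<open>Used with \<open>Z\<close> beginning at the topmost overlined multiple
  \<open>bar b'\<close>, and with \<open>Z\<close> empty and \<open>b' = 0\<close> if there is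
  none.\<close>

lemma grow_bar:
  assumes c: "valid (U @ Z @ P)" "\<forall>x\<in>set (U @ Z). part_code x" "\<forall>x\<in>set U. x mod H \<noteq> 1"
    and b': "hd (Z @ P) \<le> bar b'" "0 \<le> b'" "b' + int (count U) < d"
  shows "config (insert_bar d (U @ Z @ P))" "top_size (insert_bar d (U @ Z @ P)) = d"
    "shrink (insert_bar d (U @ Z @ P)) = U @ Z @ P"
    "wt (insert_bar d (U @ Z @ P)) = wt (U @ Z @ P) + d * (H div 2)"
proof -
  obtain X V b where *: "U = X @ V" "insert_bar d (U @ Z @ P) = advance X @ bar b # V @ Z @ P"
    "b' < b" "b + int (count X) = d" "valid (insert_bar d (U @ Z @ P))"
    using insert_bar_spec[of "[]" U "Z @ P" d b'] c b' w_pos by auto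
  have nb: "\<forall>x\<in>set (advance X). x mod H \<noteq> 1" using c(3) *(1) by (intro not_bar_advance) simp
  have vX: "valid X" using c(1) *(1) valid_appendD by (metis append_assoc)
  have "part_code (bar b)"
  proof -
    have "0 < b * H" using *(3) b'(2) H_pos by simp
    then show ?thesis using bar_mod[of b] by (simp add: part_code_def bar_def H_even)
  qed
  moreover have "\<forall>x\<in>set (advance X). part_code x" using c(2) *(1) by (intro part_code_advance) simp
  ultimately show "config (insert_bar d (U @ Z @ P))"
    unfolding config_def using *(1,2,5) c(2)
    by (intro conjI exI[of _ "advance X @ bar b # V @ Z"]) auto
  show "top_size (insert_bar d (U @ Z @ P)) = d"
    using top_size_barred(4)[OF nb] *(2,4) count_advance[OF vX] by simp
  show "shrink (insert_bar d (U @ Z @ P)) = U @ Z @ P"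
    using top_size_barred(1-3)[OF nb] *(1,2) retreat_advance[OF vX] by (simp add: shrink_def)
  have "bar b div 2 = b * (H div 2)"
    using H_even by (auto simp: bar_def elim!: evenE)
  then show "wt (insert_bar d (U @ Z @ P)) = wt (U @ Z @ P) + d * (H div 2)"
    using wt_advance[of X "bar b # V @ Z @ P"] unfolding *(2)
    by (simp add: *(1) wt_def *(4)[symmetric] algebra_simps)
qed

lemma grow_advance:
  assumes c: "config (a @ P)" "\<forall>x\<in>set a. part_code x" and nb: "\<not> barred (a @ P)"
    and d: "top_size (a @ P) < int d" "d \<le> count a"
  shows "config (advance_first d (a @ P))" "top_size (advance_first d (a @ P)) = int d"
    "shrink (advance_first d (a @ P)) = a @ P"
    "wt (advance_first d (a @ P)) = wt (a @ P) + int d * (H div 2)"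
proof -
  have v: "valid (a @ P)" using c(1) by (simp add: config_def)
  have d0: "0 < d" using d(1) top_size_0(1)[OF c(1)] by linarith
  obtain X V x Y where a: "a = X @ V @ x # Y" "length V = w - 1" "tight (V @ [x])"
    "count (X @ V @ [x]) = d" "advance (X @ V @ [x]) = advance X @ (x + H) # V"
    using prefix_window d0 d(2) by metis
  let ?i = "length X" and ?A = "X @ V @ [x]" and ?c = "a @ P" and ?Y = "Y @ P"
  define c' where "c' = advance_first d (a @ P)"
  have c'A: "c' = advance ?A @ ?Y"
    using advance_first_count[of ?A ?Y] a(1,4) by (simp add: c'_def)
  then have c'X: "c' = advance X @ (x + H) # V @ ?Y" using a(5) by simp
  have cA: "?c = ?A @ ?Y" "?c = X @ V @ x # ?Y" using a(1) by simp_all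
  have vs: "valid ?A" "valid (V @ x # ?Y)"
    using v valid_appendD cA by metis+
  have vc': "valid c'" using valid_advance'[of ?A ?Y] v cA(1) c'A by simp
  have pc: "\<forall>y\<in>set (advance ?A). part_code y" using c(2) a(1) by (intro part_code_advance) auto
  then show conf: "config (advance_first d (a @ P))"
    unfolding config_def c'_def[symmetric] using vc' c(2) a(1) c'A
    by (intro conjI exI[of _ "advance ?A @ Y"]) auto
  have "\<forall>y\<in>set (advance ?A). y mod H \<noteq> 1"
    using nb cA(1) by (intro not_bar_advance) (auto simp: barred_def)
  then have nb': "\<not> barred c'" using nb cA(1) c'A by (auto simp: barred_def)
  \<comment> \<open>A wrong window at or below the last advanced one would make
    \<open>top_size\<close> at least \<open>d\<close>.\<close>
  have right: "\<not> wrong (drop j ?c)" if "?i \<le> j" for j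
  proof
    assume wr: "wrong (drop j ?c)"
    then have "?i \<le> lowest ?c" using lowest_wrong(2)[OF wr] that by simp
    then have "count (take (?i + w) ?c) \<le> count (take (lowest ?c + w) ?c)"
      by (intro count_take_mono) simp
    moreover have "take (?i + w) ?c = ?A" using cA(1) a(2) w_pos by simp
    moreover have "top_size ?c = int (count (take (lowest ?c + w) ?c))"
      using nb wr by (auto simp: top_size_def)
    ultimately show False using d(1) a(4) by simp
  qed
  have di: "drop ?i c' = (x + H) # V @ ?Y" "drop ?i ?c = V @ x # ?Y" using c'X cA(2) by simp_all
  have ti: "tight (V @ x # ?Y)" using a(2,3) tight_window by auto
  have th: "tight ((x + H) # V @ ?Y)"
  proof -
    have "length ((x + H) # V) = w" using a(2) w_pos by simp
    moreover have "((x + H) # V @ ?Y) ! (w - 1) = last ((x + H) # V)"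
      using a(2) w_pos by (cases V rule: rev_cases) (auto simp: nth_Cons nth_append split: nat.splits)
    moreover have "above (last ((x + H) # V) + H) (x + H)"
    proof (cases V rule: rev_cases)
      case Nil
      then show ?thesis using above_shift[of "x + H"] by simp
    next
      case (snoc V' y)
      have "sorted_wrt above (V @ x # ?Y)" using vs(2) by (simp add: valid_def)
      then show ?thesis using snoc by (auto simp: sorted_wrt_append)
    qed
    ultimately show ?thesis using a(2) by (simp add: tight_def)
  qed
  have "wrong (drop ?i c')"
    using right[of ?i] ti th parity_move[OF a(2), of x ?Y] unfolding di wrong_def by simp
  moreover have "\<not> wrong (drop j c')" if ij: "?i < j" for j
  proof (cases "j < ?i + w")
    case True
    obtain n where n: "j = ?i + Suc n" using less_imp_Suc_add[OF ij] by auto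
    then have "drop j c' = drop n (V @ ?Y)" using c'X by simp
    moreover have "\<not> tight (drop n (V @ ?Y))"
      by (rule deleted_not_tight[OF vs(2)]) (use n True a(2) in auto)
    ultimately show ?thesis by (simp add: wrong_def)
  next
    case False
    then have dr: "drop j (Z @ ?Y) = drop (j - (?i + w)) ?Y" if "length Z = ?i + w" for Z
      using that by simp
    have lA: "length ?A = ?i + w" using a(2) w_pos by simp
    then have "length (advance ?A) = ?i + w" by simp
    then have "drop j c' = drop j ?c" unfolding c'A cA(1) dr[OF lA] by (rule dr)
    then show ?thesis using right ij by simp
  qed
  ultimately have low: "lowest c' = ?i" "wrong (drop ?i c')" using lowest_eqI by blast+
  have tk: "take (?i + w) c' = advance ?A" "drop (?i + w) c' = ?Y"
    using c'A a(2) w_pos by simp_all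
  have "top_size c' = int (count (advance ?A))" using nb' low tk by (auto simp: top_size_def)
  then show "top_size (advance_first d (a @ P)) = int d"
    using count_advance[OF vs(1)] a(4) by (simp add: c'_def)
  show "shrink (advance_first d (a @ P)) = a @ P"
    using nb' low tk retreat_advance[OF vs(1)] cA(1) by (simp add: shrink_def c'_def)
  show "wt (advance_first d (a @ P)) = wt (a @ P) + int d * (H div 2)"
    using wt_advance[of ?A ?Y] c'A cA(1) a(4) by (simp add: c'_def algebra_simps)
qed

lemma grow:
  assumes c: "config c" and d: "top_size c < d"
  shows "config (grow d c)" "top_size (grow d c) = d" "shrink (grow d c) = c"
    "wt (grow d c) = wt c + d * (H div 2)"
proof -
  obtain a where a: "c = a @ P" "\<forall>x\<in>set a. part_code x" "valid (a @ P)"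
    using c by (auto simp: config_def)
  have "config (grow d c) \<and> top_size (grow d c) = d \<and> shrink (grow d c) = c \<and>
    wt (grow d c) = wt c + d * (H div 2)"
  proof (cases "barred c")
    case True
    then obtain X b Y where X: "a = X @ bar b # Y" "\<forall>x\<in>set X. x mod H \<noteq> 1" "1 \<le> b"
      using barred_split a by metis
    have "b + int (count X) < d" using d X a(1) top_size_barred(4)[of X b "Y @ P"] by simp
    then show ?thesis using True grow_bar[of X "bar b # Y" b d] X a by (simp add: grow_def)
  next
    case nb: False
    show ?thesis
    proof (cases "int (count a) < d")
      case True
      have "hd P \<le> bar 0" using P_mult P_nonempty hd_in_set by (fastforce simp: bar_def)
      moreover have "\<forall>x\<in>set a. x mod H \<noteq> 1" using nb a(1) by (auto simp: barred_def)
      ultimately show ?thesis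
        using True grow_bar[of a "[]" 0 d] a body_eq[OF a(2)] by (simp add: grow_def)
    next
      case False
      have "0 \<le> d" using d top_size_0(1)[OF c] by simp
      then show ?thesis
        using False nb grow_advance[of a "nat d"] a c d body_eq[OF a(2)] by (simp add: grow_def)
    qed
  qed
  then show "config (grow d c)" "top_size (grow d c) = d" "shrink (grow d c) = c"
    "wt (grow d c) = wt c + d * (H div 2)" by auto
qed

lemma config_retreat:
  assumes X': "valid (X' @ Y @ P)" "\<forall>x\<in>set (X' @ Y). part_code x" "\<forall>x\<in>set X'. x mod H \<noteq> 1"
    and v: "valid (retreat X' @ Y @ P)"
  shows "config (retreat X' @ Y @ P)" "\<forall>x\<in>set (retreat X' @ Y). part_code x"
proof -
  have vX: "valid X'" using X'(1) valid_appendD by blast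
  have nb: "\<forall>x\<in>set (retreat X'). x mod H \<noteq> 1" using not_bar_retreat X'(3) by blast
  have "part_code y" if y: "y \<in> set (retreat X')" for y
  proof -
    have "part_code y \<or> part_code (y + H)" using retreat_props[OF y] X'(2) by auto
    then have s: "even y \<longrightarrow> H dvd y" "odd y \<longrightarrow> y mod H \<in> insert 1 Rs"
      using H_even by (auto simp: part_code_def)
    moreover have "1 < y"
      using above_tail[of "retreat X' @ Y" y] v y s(1) nb by auto
    ultimately show ?thesis by (simp add: part_code_def)
  qed
  then show "\<forall>x\<in>set (retreat X' @ Y). part_code x" using X'(2) by auto
  then show "config (retreat X' @ Y @ P)"
    unfolding config_def using v by (intro conjI exI[of _ "retreat X' @ Y"]) auto
qed

text \<open>The deleted multiple leaves space for the retreat above it. Since windows stack up in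
  steps of \<open>H\<close>, \<open>b\<close> exceeds the number of windows between it and the next
  overlined multiple plus the size factor of the latter, or the number of all real windows below it.
  Hence \<open>top_size\<close> drops, and \<open>grow\<close> takes the inserting branch
  again.\<close>

lemma shrink_bar:
  assumes c: "valid (X' @ bar b # Y @ P)" "\<forall>x\<in>set (X' @ bar b # Y). part_code x"
    and nb: "\<forall>x\<in>set X'. x mod H \<noteq> 1"
  shows "config (shrink (X' @ bar b # Y @ P))"
    "top_size (shrink (X' @ bar b # Y @ P)) < top_size (X' @ bar b # Y @ P)"
    "grow (top_size (X' @ bar b # Y @ P)) (shrink (X' @ bar b # Y @ P)) = X' @ bar b # Y @ P"
proof -
  let ?X = "retreat X'" and ?c = "X' @ bar b # Y @ P"
  have top: "barred ?c" "upper ?c = X'" "lower ?c = bar b # Y @ P" "top_size ?c = b + int (count X')"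
    using top_size_barred[OF nb] by auto
  then have sh: "shrink ?c = ?X @ Y @ P" by (simp add: shrink_def)
  have vX': "valid X'" using c(1) valid_appendD by blast
  have vX: "valid (X' @ Y @ P)" "separated X' (Y @ P)" using valid_delete[OF c(1)] by auto
  then have v: "valid (?X @ Y @ P)" by (rule valid_retreat)
  have pcX: "\<forall>x\<in>set (X' @ Y). part_code x" using c(2) by simp
  note conf = config_retreat[OF vX(1) pcX nb v]
  then show "config (shrink ?c)" using sh by simp
  have adv: "advance ?X = X'" using advance_retreat[OF vX'] .
  have "valid ?X" using v valid_appendD by blast
  then have cnt: "count X' = count ?X" using count_advance[of ?X] adv by simp
  have nbX: "\<forall>x\<in>set ?X. x mod H \<noteq> 1" using not_bar_retreat nb by blast
  have count_app: "count (?X @ Y1) = count ?X + count Y1" if "Y @ P = Y1 @ Y2" for Y1 Y2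
    using count_append_advance[of ?X "bar b" Y1 Y2] c(1) that adv by simp
  have vb: "valid (bar b # Y @ P)" using c(1) valid_appendD by blast
  have cb: "t + H * int (count Y1) < bar b" if "Y @ P = Y1 @ Y2" "\<forall>y\<in>set (bar b # Y1). t < y" for t Y1 Y2
  proof -
    have "valid ((bar b # Y1) @ Y2)" using vb that(1) by simp
    then have "valid (bar b # Y1)" using valid_appendD by blast
    then show ?thesis using count_bound that(2) by blast
  qed
  have cY: "int (count Y) < b"
  proof -
    \<comment> \<open>The lower bound 1 is \<open>bar 0\<close>, and all codes of real parts exceed
      it.\<close>
    have "1 + H * int (count Y) < bar b"
      by (rule cb[of Y P]) (use c(2) in \<open>auto simp: part_code_def\<close>)
    then have "H * int (count Y) < H * b" by (simp add: bar_def mult.commute)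
    then show ?thesis using mult_less_cancel_left_pos[OF H_pos] by blast
  qed
  have lt: "top_size (?X @ Y @ P) < top_size ?c"
  proof (cases "barred (?X @ Y @ P)")
    case True
    obtain X2 b2 Y2 where *: "?X @ Y = X2 @ bar b2 # Y2" "\<forall>x\<in>set X2. x mod H \<noteq> 1" "1 \<le> b2"
      using barred_split[of "?X @ Y"] v conf(2) True by auto
    have "X2 = takeWhile (\<lambda>x. x mod H \<noteq> 1) (?X @ Y)"
      using *(1,2) bar_mod by simp
    also have "\<dots> = ?X @ takeWhile (\<lambda>x. x mod H \<noteq> 1) Y" using nbX by simp
    finally obtain Y1 where X2: "X2 = ?X @ Y1" by blast
    then have Y1: "X2 = ?X @ Y1" "Y = Y1 @ bar b2 # Y2" using *(1) by auto
    have "top_size (?X @ Y @ P) = b2 + int (count (?X @ Y1))"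
      using top_size_barred(4)[OF *(2), of b2 "Y2 @ P"] Y1 by simp
    also have "\<dots> = b2 + int (count X') + int (count Y1)"
      using count_app[of Y1 "bar b2 # Y2 @ P"] Y1 cnt by simp
    also have "bar b2 + H * int (count Y1) < bar b"
    proof (rule cb)
      show "Y @ P = Y1 @ bar b2 # Y2 @ P" using Y1 by simp
      have "sorted_wrt above (bar b # Y1 @ bar b2 # Y2 @ P)" using vb Y1 by (simp add: valid_def)
      then have "\<forall>y\<in>set (bar b # Y1). above y (bar b2)" by (auto simp: sorted_wrt_append)
      then show "\<forall>y\<in>set (bar b # Y1). bar b2 < y" using above_odd odd_bar by blast
    qed
    then have "H * (b2 + int (count Y1)) < H * b" by (simp add: bar_def algebra_simps)
    then have "b2 + int (count Y1) < b" using H_pos by simp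
    ultimately show ?thesis using top(4) by simp
  next
    case False
    have "top_size (?X @ Y @ P) \<le> int (count (?X @ Y))"
    proof (cases "\<exists>i. wrong (drop i (?X @ Y @ P))")
      case True
      let ?i = "lowest (?X @ Y @ P)"
      have "wrong (drop ?i (?X @ Y @ P))" using lowest_wrong(1) True by blast
      then have "?i + w \<le> length (?X @ Y)"
        using wrong_in_body[of "?X @ Y"] v config_regular[OF conf(1) False] by simp
      then have "take (?i + w) (?X @ Y @ P) = take (?i + w) (?X @ Y)" by simp
      also have "count (take (?i + w) (?X @ Y)) \<le> count (?X @ Y)"
        using count_take_mono[of "?i + w" "length (?X @ Y)" "?X @ Y"] \<open>?i + w \<le> _\<close> by simp
      finally show ?thesis using False True by (simp add: top_size_def)
    next
      case nw: False
      then show ?thesis using False by (simp add: top_size_def)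
    qed
    then show ?thesis using count_app[of Y P] cY cnt top(4) by simp
  qed
  then show "top_size (shrink ?c) < top_size ?c" using sh by simp
  have "insert_bar (b + int (count ?X)) (?X @ Y @ P) = advance ?X @ bar b # Y @ P"
    by (rule insert_bar_advance) (use c(1) adv nbX in auto)
  moreover have "int (count (?X @ Y)) < b + int (count ?X)"
    using count_app[of Y P] cY by simp
  moreover have "filter (\<lambda>x. 0 < x) (?X @ Y @ P) = ?X @ Y" using body_eq[OF conf(2)] by simp
  ultimately show "grow (top_size ?c) (shrink ?c) = ?c"
    unfolding sh top(4) grow_def using cnt adv by (simp only: if_True simp_thms)
qed

text \<open>The lowest wrong window may retreat: a tight window starting inside it, or just after it
  within span \<open>2 * H\<close>, would share its parity and be a lower wrong one. Once retreated
  it is right and tight, so no wrong window overlaps it, and the remaining ones lie entirely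
  above.\<close>

lemma shrink_wrong:
  assumes c: "config (a @ P)" "\<forall>x\<in>set a. part_code x" and nb: "\<not> barred (a @ P)"
    and wr: "wrong (drop i0 (a @ P))"
  shows "config (shrink (a @ P))" "top_size (shrink (a @ P)) < top_size (a @ P)"
    "grow (top_size (a @ P)) (shrink (a @ P)) = a @ P"
proof -
  let ?c = "a @ P"
  define i where "i = lowest ?c"
  have v: "valid ?c" using c(1) by (simp add: config_def)
  have reg: "regular ?c" using config_regular c(1) nb by blast
  have wi: "wrong (drop i ?c)" unfolding i_def using lowest_wrong(1)[OF wr] .
  have right: "\<not> wrong (drop j ?c)" if "i < j" for j
    using lowest_wrong(2)[of j ?c] that unfolding i_def by auto
  have ti: "tight (drop i ?c)" using wi by (simp add: wrong_def)
  have ia: "i + w \<le> length a" using wrong_in_body[OF v reg wi] .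
  define X' where "X' = take (i + w) a"
  define Y where "Y = drop (i + w) a"
  have a: "a = X' @ Y" by (simp add: X'_def Y_def)
  have lX': "length X' = i + w" using ia by (simp add: X'_def)
  obtain u V where uV: "drop i X' = u # V" "length V = w - 1"
    using lX' w_pos by (cases "drop i X'") (auto dest: arg_cong[of _ _ length])
  have X'uV: "X' = take i X' @ u # V" using uV(1) by (metis append_take_drop_id)
  have di: "drop i ?c = u # V @ Y @ P" using a uV(1) lX' by simp
  have "length (u # V) = w" using uV(2) w_pos by simp
  then have tuV: "tight (u # V)" using ti tight_prefix[of "u # V" "Y @ P"] unfolding di by simp
  have same: "\<not> tight (drop j ?c)" if j: "i < j" "j < i + w" for j
  proof
    assume tj: "tight (drop j ?c)"
    then have "even (parity (drop i ?c) - parity (drop j ?c))"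
      using parity_overlap[OF v reg _ j(2) ti tj] j(1) by simp
    then have "wrong (drop j ?c)" using wi tj by (simp add: wrong_def)
    then show False using right j(1) by blast
  qed
  have sep: "separated X' (Y @ P)"
    unfolding separated_def
  proof (intro conjI allI impI)
    fix j assume j: "j < length X'" "length X' < j + w"
    then have "drop j (X' @ Y @ P) = drop j ?c" using a by simp
    then show "\<not> tight (drop j (X' @ Y @ P))" using same[of j] j lX' by simp
  next
    assume l: "w \<le> length X' \<and> w \<le> length (Y @ P)"
    define z where "z = (Y @ P) ! (w - 1)"
    have lc: "length ?c = i + w + length (Y @ P)" using a lX' by simp
    have nth: "?c ! (i + w + n) = (Y @ P) ! n" for n using a lX' by (simp add: nth_append)
    have z: "?c ! (i + w + w - 1) = z" using nth[of "w - 1"] w_pos by (simp add: z_def)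
    have u: "X' ! (length X' - w) = ?c ! i" using a lX' w_pos by (simp add: nth_append)
    show "\<not> above ((Y @ P) ! (w - 1) + 2 * H) (X' ! (length X' - w))"
    proof
      assume "above ((Y @ P) ! (w - 1) + 2 * H) (X' ! (length X' - w))"
      then have ab: "above (z + 2 * H) (?c ! i)" unfolding u z_def[symmetric] .
      have far: "\<not> above (?c ! (i + w) + H) (?c ! i)"
        by (rule valid_far[OF v]) (use lc P_nonempty in auto)
      \<comment> \<open>The part at \<open>i + w\<close> is at least \<open>H\<close> below the part
        at \<open>i\<close>, which is at most \<open>z + 2 * H\<close>; so the \<open>w\<close>
        parts from \<open>i + w\<close> on form a tight window.\<close>
      have "above (z + H) (?c ! (i + w))"
      proof (cases "?c ! (i + w) = z + H")
        case True
        then have "even (z + 2 * H)" using ab far by (auto simp: above_def)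
        then have "even (z + H)" using H_even by simp
        then show ?thesis using True by (simp add: above_def)
      next
        case False
        have "?c ! i \<le> z + 2 * H" "?c ! (i + w) + H \<le> ?c ! i"
          using ab far by (auto simp: above_def)
        then show ?thesis using False by (auto simp: above_def)
      qed
      then have tw: "tight (drop (i + w) ?c)" unfolding tight_drop z using lc l by simp
      have "even (parity (drop i ?c) - parity (drop (i + w) ?c))"
        by (rule parity_eq[OF v reg _ _ ti tw]) (use ab z in auto)
      then have "wrong (drop (i + w) ?c)" using wi tw by (simp add: wrong_def)
      then show False using right[of "i + w"] w_pos by simp
    qed
  qed
  let ?X = "retreat X'"
  have nbX': "\<forall>x\<in>set X'. x mod H \<noteq> 1" using nb a by (auto simp: barred_def)
  have va: "valid (X' @ Y @ P)" using v a by simp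
  have vr: "valid (?X @ Y @ P)" using valid_retreat[OF va sep] .
  have "\<forall>x\<in>set (X' @ Y). part_code x" using c(2) a by simp
  note conf = config_retreat[OF va this nbX' vr]
  have tk: "take (lowest ?c + w) ?c = X'" "drop (lowest ?c + w) ?c = Y @ P"
    using ia by (simp_all add: X'_def Y_def i_def)
  then have sh: "shrink ?c = ?X @ Y @ P" using nb by (simp add: shrink_def)
  then show "config (shrink ?c)" using conf by simp
  have top: "top_size ?c = int (count X')" using nb wr tk by (auto simp: top_size_def)
  have vX': "valid X'" using va valid_appendD by blast
  have adv: "advance ?X = X'" using advance_retreat[OF vX'] .
  have "valid ?X" using vr valid_appendD by blast
  then have cnt: "count X' = count ?X" using count_advance[of ?X] adv by simp
  define X0 where "X0 = retreat (take i X')"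
  have X: "?X = X0 @ V @ [u - H]"
    using retreat_window[OF uV(2) tuV, of "take i X'"] X'uV by (simp add: X0_def)
  have lX0: "length X0 = i" using lX' by (simp add: X0_def)
  have nbr: "\<not> barred (?X @ Y @ P)"
    using nb a not_bar_retreat[OF nbX'] by (auto simp: barred_def)
  have tV: "tight (V @ [u - H])"
  proof -
    have "above u (hd (V @ [u - H]))"
    proof (cases V)
      case Nil
      then show ?thesis using above_shift[of "u - H"] by simp
    next
      case (Cons y V')
      have "sorted_wrt above X'" using vX' by (simp add: valid_def)
      then have "sorted_wrt above (u # V)" using X'uV by (metis sorted_wrt_append)
      then show ?thesis using Cons by simp
    qed
    then show ?thesis using tight_window[of V "u - H" "[]"] uV(2) by simp
  qed
  let ?d = "?X @ Y @ P"
  have did: "drop i ?d = V @ (u - H) # Y @ P" using X lX0 by simp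
  have tid: "tight (drop i ?d)"
    using tV tight_window[of V "u - H"] uV(2) unfolding did by simp
  have "parity (drop i ?c) = parity (drop i ?d) + 1"
    using parity_move[OF uV(2), of "u - H" "Y @ P"] unfolding di did by simp
  then have ri: "even (parity (drop i ?d) - ref)" using wi by (simp add: wrong_def)
  have regd: "regular ?d" using config_regular conf(1) nbr by blast
  have low: "j + w \<le> i" if wj: "wrong (drop j ?d)" for j
  proof (rule ccontr)
    assume "\<not> j + w \<le> i"
    then consider "i + w \<le> j" | "i \<le> j" "j < i + w" | "j < i" "i < j + w" by linarith
    then show False
    proof cases
      case 1
      then have "drop j ?d = drop j ?c" using a lX' by simp
      then show False using right[of j] wj 1 w_pos by simp
    next
      case 2
      have tj: "tight (drop j ?d)" using wj by (simp add: wrong_def)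
      have "even (parity (drop i ?d) - parity (drop j ?d))"
        by (rule parity_overlap[OF vr regd 2 tid tj])
      then show False using ri wj by (simp add: wrong_def)
    next
      case 3
      have tj: "tight (drop j ?d)" using wj by (simp add: wrong_def)
      have "even (parity (drop j ?d) - parity (drop i ?d))"
        by (rule parity_overlap[OF vr regd _ 3(2) tj tid]) (use 3 in simp)
      then show False using ri wj by (simp add: wrong_def)
    qed
  qed
  have "count X0 < count ?X"
  proof -
    have "count (V @ [u - H]) = 1" using tV uV(2) count_window[of V "u - H" "[]"] by simp
    then show ?thesis using count_append_le[of X0 "V @ [u - H]"] X by simp
  qed
  moreover have "top_size ?d \<le> int (count X0)"
  proof (cases "\<exists>j. wrong (drop j ?d)")
    case True
    then have "lowest ?d + w \<le> i" using low lowest_wrong(1) by blast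
    then have "count (take (lowest ?d + w) ?d) \<le> count (take i ?d)" by (rule count_take_mono)
    moreover have "take i ?d = X0" using X lX0 by simp
    ultimately show ?thesis using nbr True by (simp add: top_size_def)
  next
    case False
    then show ?thesis using nbr by (simp add: top_size_def)
  qed
  ultimately show "top_size (shrink ?c) < top_size ?c" using sh top cnt by simp
  have "count ?X \<le> count (?X @ Y)" using count_append_le[of ?X Y] by simp
  moreover have "filter (\<lambda>x. 0 < x) ?d = ?X @ Y" using body_eq[OF conf(2)] by simp
  ultimately have cond: "\<not> (barred ?d \<or> int (count (filter (\<lambda>x. 0 < x) ?d)) < int (count ?X))"
    using nbr by (metis not_less of_nat_le_iff)
  have "advance_first (count ?X) ?d = ?c" using advance_first_count[of ?X "Y @ P"] adv a by simp
  then show "grow (top_size ?c) (shrink ?c) = ?c"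
    unfolding sh top cnt grow_def if_not_P[OF cond] nat_int .
qed

lemma shrink:
  assumes c: "config c" and d: "top_size c \<noteq> 0"
  shows "config (shrink c)" "top_size (shrink c) < top_size c" "grow (top_size c) (shrink c) = c"
proof -
  obtain a where a: "c = a @ P" "\<forall>x\<in>set a. part_code x" "valid (a @ P)"
    using c by (auto simp: config_def)
  have "config (shrink c) \<and> top_size (shrink c) < top_size c \<and> grow (top_size c) (shrink c) = c"
  proof (cases "barred c")
    case True
    then obtain X b Y where X: "a = X @ bar b # Y" "\<forall>x\<in>set X. x mod H \<noteq> 1"
      using barred_split a by metis
    then show ?thesis using shrink_bar[of X b Y] a by simp
  next
    case False
    then obtain i where "wrong (drop i c)" using d top_size_0(2)[OF c] by blast
    then show ?thesis using shrink_wrong[of a i] a c False by simp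
  qed
  then show "config (shrink c)" "top_size (shrink c) < top_size c" "grow (top_size c) (shrink c) = c"
    by auto
qed

section \<open>Iterated insertion\<close>

definition base :: "int list set" where
  "base = {c. config c \<and> \<not> barred c \<and> (\<forall>i. \<not> wrong (drop i c))}"

text \<open>\<open>foldr\<close> on a decreasing list inserts the smallest size first.\<close>

definition build :: "int list \<Rightarrow> int list \<Rightarrow> int list" where
  "build ds c = foldr grow ds c"

lemma build:
  assumes "c \<in> base" "sorted_wrt (>) ds" "\<forall>d\<in>set ds. 0 < d"
  shows "config (build ds c)" "top_size (build ds c) = (if ds = [] then 0 else hd ds)"
    "wt (build ds c) = wt c + sum_list ds * (H div 2)"
proof -
  have "config (build ds c) \<and> top_size (build ds c) = (if ds = [] then 0 else hd ds) \<and>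
    wt (build ds c) = wt c + sum_list ds * (H div 2)" using assms(2,3)
  proof (induction ds)
    case Nil
    then show ?case using assms(1) top_size_0 by (simp add: build_def base_def)
  next
    case (Cons d ds)
    then have "config (build ds c)" "top_size (build ds c) < d"
      "wt (build ds c) = wt c + sum_list ds * (H div 2)"
      by (cases ds; simp)+
    then show ?case using grow[of "build ds c" d] by (simp add: build_def algebra_simps)
  qed
  then show "config (build ds c)" "top_size (build ds c) = (if ds = [] then 0 else hd ds)"
    "wt (build ds c) = wt c + sum_list ds * (H div 2)" by auto
qed

text \<open>\<open>top_size\<close> reveals the size inserted last, and \<open>shrink\<close>
  removes it.\<close>

lemma build_inject:
  assumes "c \<in> base" "c' \<in> base" "build ds c = build ds' c'"
    "sorted_wrt (>) ds" "\<forall>d\<in>set ds. 0 < d" "sorted_wrt (>) ds'" "\<forall>d\<in>set ds'. 0 < d"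
  shows "ds = ds' \<and> c = c'"
  using assms(3-)
proof (induction ds arbitrary: ds')
  case Nil
  then have "ds' = []"
    using build(2)[OF assms(1), of "[]"] build(2)[OF assms(2), of ds'] by (cases ds') auto
  then show ?case using Nil by (simp add: build_def)
next
  case (Cons d ds)
  have "top_size (build ds' c') = d" using build(2)[OF assms(1), of "d # ds"] Cons.prems by simp
  then obtain ds2 where ds': "ds' = d # ds2"
    using build(2)[OF assms(2), of ds'] Cons.prems by (cases ds') auto
  have s: "shrink (build (d # es) e) = build es e"
    if "e \<in> base" "sorted_wrt (>) (d # es)" "\<forall>x\<in>set (d # es). 0 < x" for es e
  proof -
    have "config (build es e)" "top_size (build es e) < d"
      using build(1,2)[of e es] that by (cases es; simp)+
    then show ?thesis using grow(3) by (simp add: build_def)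
  qed
  have "build ds c = build ds2 c'"
    using s[OF assms(1), of ds] s[OF assms(2), of ds2] Cons.prems ds' by simp
  then show ?case using Cons.IH[of ds2] Cons.prems ds' by simp
qed

lemma build_surj:
  assumes "config c"
  shows "\<exists>ds. \<exists>e\<in>base. sorted_wrt (>) ds \<and> (\<forall>d\<in>set ds. 0 < d) \<and> build ds e = c"
  using assms
proof (induction "nat (top_size c)" arbitrary: c rule: less_induct)
  case less
  show ?case
  proof (cases "top_size c = 0")
    case True
    then have "c \<in> base" using less.prems top_size_0 by (simp add: base_def)
    then show ?thesis by (intro exI[of _ "[]"] bexI[of _ c]) (auto simp: build_def)
  next
    case False
    note s = shrink[OF less.prems False]
    have pos: "0 \<le> top_size (shrink c)" using top_size_0(1)[OF s(1)] .
    then obtain ds e where e: "e \<in> base" "sorted_wrt (>) ds" "\<forall>d\<in>set ds. 0 < d" "build ds e = shrink c"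
      using less.hyps[of "shrink c"] s by auto
    have t: "top_size (shrink c) = (if ds = [] then 0 else hd ds)" using build(2) e by metis
    have "sorted_wrt (>) (top_size c # ds)"
      using e(2) s(2) t by (cases ds) auto
    moreover have "build (top_size c # ds) e = c" using e(4) s(3) by (simp add: build_def)
    ultimately show ?thesis using e pos s(2)
      by (intro exI[of _ "top_size c # ds"] bexI[of _ e]) auto
  qed
qed

end

section \<open>Encoding overpartitions\<close>

definition code :: "part \<Rightarrow> int" where
  "code x = 2 * int (part_size x) + of_bool (overlined x)"

lemma odd_code [simp]: "odd (code x) \<longleftrightarrow> overlined x" and even_code [simp]: "even (code x) \<longleftrightarrow> \<not> overlined x"
  by (simp_all add: code_def)

lemma code_div_2: "code x div 2 = int (part_size x)"
  by (simp add: code_def)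

lemma code_less_iff [simp]: "code x < code y \<longleftrightarrow> x < y"
  by (auto simp: code_def less_part_def of_bool_def)

lemma code_le_iff [simp]: "code x \<le> code y \<longleftrightarrow> x \<le> y"
  by (simp add: not_less[symmetric] del: not_less)

lemma code_eq_iff [simp]: "code x = code y \<longleftrightarrow> x = y"
  by (auto simp: eq_iff simp flip: code_le_iff)

lemma code_shift: "code (shift \<eta> x) = code x + 2 * int \<eta>"
  by (simp add: code_def shift_def)

lemma code_surj: "0 \<le> x \<Longrightarrow> \<exists>y. code y = x"
  by (rule exI[of _ "Part (nat (x div 2)) (odd x)"]) (auto simp: code_def elim!: oddE)

lemma above_code: "above (code x) (code y) \<longleftrightarrow> y < x \<or> (x = y \<and> \<not> overlined x)"
  by (simp add: above_def)

lemma map_code_eq_iff [simp]: "map code xs = map code ys \<longleftrightarrow> xs = ys"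
  by (simp add: inj_map_eq_map inj_def)

lemma overpartition_code:
  "overpartition \<pi> \<longleftrightarrow> sorted_wrt above (map code \<pi>) \<and> (\<forall>x\<in>set \<pi>. 0 < part_size x)"
proof -
  have "sorted_wrt (\<ge>) \<pi> \<and> (\<forall>t. count_list \<pi> (Part t True) \<le> 1) \<longleftrightarrow> sorted_wrt above (map code \<pi>)"
  proof (induction \<pi>)
    case (Cons x xs)
    have "(\<forall>t. count_list (x # xs) (Part t True) \<le> 1) \<longleftrightarrow>
      (\<forall>t. count_list xs (Part t True) \<le> 1) \<and> (overlined x \<longrightarrow> x \<notin> set xs)"
    proof (cases "overlined x")
      case True
      then have x: "x = Part (part_size x) True" by (cases x) auto
      have "(\<forall>t. count_list (x # xs) (Part t True) \<le> 1) \<longleftrightarrow>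
        count_list xs x = 0 \<and> (\<forall>t. count_list xs (Part t True) \<le> 1)"
        by (subst (1 2) x) (auto simp: le_Suc_eq)
      then show ?thesis using True by (auto simp: count_list_0_iff)
    next
      case False
      then have "x \<noteq> Part t True" for t by auto
      then show ?thesis using False by simp
    qed
    moreover have "sorted_wrt above (map code (x # xs)) \<longleftrightarrow>
      (\<forall>y\<in>set xs. y \<le> x) \<and> (overlined x \<longrightarrow> x \<notin> set xs) \<and> sorted_wrt above (map code xs)"
      by (auto simp: above_code order.order_iff_strict)
    ultimately show ?case using Cons.IH unfolding sorted_wrt.simps(2) by blast
  qed simp
  then show ?thesis by (auto simp: overpartition_def)
qed

text \<open>The entries up to \<open>h\<close> form a final segment. This puts the bound (4) into
  the positional form of the distance condition.\<close>

lemma length_filter_le_sorted: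
  fixes h :: int
  assumes "sorted_wrt above xs"
  shows "length (filter (\<lambda>x. x \<le> h) xs) \<le> n \<longleftrightarrow> (\<forall>i. i + n < length xs \<longrightarrow> h < xs ! i)"
  using assms
proof (induction xs)
  case (Cons x xs)
  show ?case
  proof (cases "x \<le> h")
    case True
    have "y \<le> h" if "y \<in> set xs" for y using Cons.prems True that by (auto simp: above_def)
    then have f: "filter (\<lambda>x. x \<le> h) xs = xs" by (simp add: filter_True)
    show ?thesis
    proof
      assume "length (filter (\<lambda>x. x \<le> h) (x # xs)) \<le> n"
      then show "\<forall>i. i + n < length (x # xs) \<longrightarrow> h < (x # xs) ! i" using True f by simp
    next
      assume "\<forall>i. i + n < length (x # xs) \<longrightarrow> h < (x # xs) ! i"
      then have "0 + n < length (x # xs) \<longrightarrow> h < (x # xs) ! 0" by blast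
      then show "length (filter (\<lambda>x. x \<le> h) (x # xs)) \<le> n" using True f by simp
    qed
  next
    case False
    have "(\<forall>i. i + n < length (x # xs) \<longrightarrow> h < (x # xs) ! i) \<longleftrightarrow>
      (\<forall>i. i + n < length xs \<longrightarrow> h < xs ! i)"
      using False by (auto simp: nth_Cons split: nat.split)
    then show ?thesis using False Cons by simp
  qed
qed simp

text \<open>Overlined parts do not repeat, so none before place \<open>i\<close> is at most
  \<open>\<pi> ! i\<close>.\<close>

lemma overlined_upto_nth:
  assumes s: "sorted_wrt above (map code \<pi>)" and i: "i < length \<pi>"
  shows "overlined_upto \<pi> (\<pi> ! i) = length (filter odd (drop i (map code \<pi>)))"
proof -
  have "filter (\<lambda>y. overlined y \<and> y \<le> \<pi> ! i) (take i \<pi>) = []"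
  proof -
    have "\<not> (overlined (\<pi> ! j) \<and> \<pi> ! j \<le> \<pi> ! i)" if "j < i" for j
    proof -
      have "above (code (\<pi> ! j)) (code (\<pi> ! i))"
        using s i that by (simp add: sorted_wrt_iff_nth_less)
      then show ?thesis by (auto simp: above_code)
    qed
    then show ?thesis by (auto simp: filter_empty_conv in_set_conv_nth)
  qed
  moreover have "filter (\<lambda>y. overlined y \<and> y \<le> \<pi> ! i) (drop i \<pi>) = filter overlined (drop i \<pi>)"
  proof (rule filter_cong)
    fix y assume "y \<in> set (drop i \<pi>)"
    then obtain j where j: "y = \<pi> ! (i + j)" "i + j < length \<pi>" by (auto simp: in_set_conv_nth)
    have "y \<le> \<pi> ! i"
    proof (cases j)
      case (Suc n)
      have "above (code (\<pi> ! i)) (code y)"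
        using s j Suc by (simp add: sorted_wrt_iff_nth_less)
      then show ?thesis by (auto simp: above_code)
    qed (use j in simp)
    then show "(overlined y \<and> y \<le> \<pi> ! i) = overlined y" by simp
  qed simp
  moreover have "filter (\<lambda>y. overlined y \<and> y \<le> \<pi> ! i) \<pi> =
    filter (\<lambda>y. overlined y \<and> y \<le> \<pi> ! i) (take i \<pi>) @ filter (\<lambda>y. overlined y \<and> y \<le> \<pi> ! i) (drop i \<pi>)"
    by (metis append_take_drop_id filter_append)
  ultimately have "overlined_upto \<pi> (\<pi> ! i) = length (filter overlined (drop i \<pi>))"
    by (simp add: overlined_upto_def)
  then show ?thesis by (simp add: drop_map filter_map o_def)
qed

section \<open>Overpartitions as configurations\<close>

locale encoding =
  fixes m \<eta> k r :: nat and \<alpha> :: "nat \<Rightarrow> nat"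
  assumes eta_pos: "0 < \<eta>" and alpha_less: "\<forall>i\<in>{1..m}. \<alpha> i < \<eta>"
    and r_le_k: "r \<le> k" and m_less_k: "m < k" and r_pos: "1 \<le> r" and k_ge2: "2 \<le> k"
begin

definition period :: int where
  "period = 2 * int \<eta>"

definition width :: nat where
  "width = k - 1"

definition residues :: "int set" where
  "residues = (\<lambda>i. 2 * int (\<alpha> i) + 1) ` {1..m}"

definition tail :: "int list" where
  "tail = replicate (k - r) 0 @ replicate (r - 1) (- period)"

lemma k_eq: "k = Suc width"
  using k_ge2 by (simp add: width_def)

lemma k_diff: "k - 1 = width" "k - 2 = width - 1"
  using k_ge2 by (simp_all add: width_def)

lemma period_pos: "0 < period" and width_pos: "0 < width"
  using eta_pos k_ge2 by (simp_all add: period_def width_def)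

lemma filter_odd_tail: "filter odd tail = []"
  by (auto simp: tail_def period_def filter_empty_conv)

lemma above_replicate: "even x \<Longrightarrow> sorted_wrt above (replicate n x)"
  by (induction n) (auto simp: above_def)

text \<open>The tail encodes the condition on small parts: together with it, having at most \<open>r - 1\<close> parts
  up to \<open>\<eta>\<close> is an instance of the distance condition. It is itself a tight window
  whose parity is the reference value \<open>r - 1\<close>.\<close>

sublocale bar_insertion period width tail "int r - 1" residues
proof
  show "0 < period" "0 < width" by (rule period_pos width_pos)+
  show "even period" by (simp add: period_def)
  have w: "windows period width" using period_pos width_pos by unfold_locales (auto simp: period_def)
  show len: "length tail = width" using r_le_k r_pos k_eq by (simp add: tail_def)
  show "\<forall>x\<in>set tail. x \<le> 0 \<and> period dvd x" using period_pos by (auto simp: tail_def)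
  have "last tail \<in> set tail" using len width_pos by (intro last_in_set) auto
  then show "- period \<le> last tail" using period_pos by (auto simp: tail_def)
  have tn: "tail ! n = - period \<or> tail ! n = 0" if "n < width" for n
    using nth_mem[of n tail] that len by (auto simp: tail_def)
  have "above (tail ! (width - 1) + period) (tail ! 0)"
    using tn[of "width - 1"] tn[of 0] width_pos period_pos by (auto simp: above_def period_def)
  then show "windows.tight period width tail"
    unfolding windows.tight_def[OF w] using len by simp
  have "(\<Sum>x\<leftarrow>tail. x div period) = - int (r - 1)"
    using period_pos by (simp add: tail_def sum_list_replicate zdiv_zminus1_eq_if)
  then have "windows.parity period width tail = - int (r - 1)"
    unfolding windows.parity_def[OF w] filter_odd_tail using len by simp
  moreover have "even (- int (r - 1) - (int r - 1))" using r_pos by (simp add: of_nat_diff)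
  ultimately show "even (windows.parity period width tail - (int r - 1))" by simp
  show "finite residues" by (simp add: residues_def)
  have "card residues \<le> m" unfolding residues_def using card_image_le[of "{1..m}"] by fastforce
  then show "card residues \<le> width" using m_less_k k_eq by simp
qed

definition encode :: "part list \<Rightarrow> int list" where
  "encode \<pi> = map code \<pi> @ tail"

lemma code_gt_1: "1 < code x \<longleftrightarrow> 0 < part_size x"
  by (auto simp: code_def)

lemma dvd_code: "\<not> overlined x \<Longrightarrow> period dvd code x \<longleftrightarrow> \<eta> dvd part_size x"
  by (simp add: code_def period_def)

lemma code_shift_period: "code (shift \<eta> x) = code x + period"
  by (simp add: code_shift period_def)

lemma code_mod: "code x mod period = 2 * int (part_size x mod \<eta>) + of_bool (overlined x)"
proof -
  have d: "code x = period * int (part_size x div \<eta>) + (2 * int (part_size x mod \<eta>) + of_bool (overlined x))"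
  proof -
    have "int (part_size x) = int \<eta> * int (part_size x div \<eta>) + int (part_size x mod \<eta>)"
      by (metis mult_div_mod_eq of_nat_add of_nat_mult)
    then show ?thesis by (simp add: code_def period_def algebra_simps)
  qed
  have "int (part_size x mod \<eta>) < int \<eta>" using eta_pos by simp
  then have "2 * int (part_size x mod \<eta>) + of_bool (overlined x) < period"
    unfolding period_def by (cases "overlined x") simp_all
  then show ?thesis unfolding d by simp
qed

lemma code_div: "code x div period = int (part_size x div \<eta>)"
  unfolding period_def using code_div_2[of x] by (simp add: zdiv_zmult2_eq zdiv_int)

lemma part_code_code:
  "part_code (code x) \<longleftrightarrow> 0 < part_size x \<and>
     ([part_size x = 0] (mod \<eta>) \<or> (\<exists>i\<in>{1..m}. [part_size x = \<alpha> i] (mod \<eta>))) \<and>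
     (\<not> overlined x \<longrightarrow> \<eta> dvd part_size x)"
proof (cases "overlined x")
  case True
  have "2 * int (part_size x mod \<eta>) + 1 \<in> insert 1 residues \<longleftrightarrow>
    part_size x mod \<eta> = 0 \<or> (\<exists>i\<in>{1..m}. part_size x mod \<eta> = \<alpha> i)"
    by (auto simp: residues_def image_iff)
  moreover have "part_size x mod \<eta> = \<alpha> i \<longleftrightarrow> [part_size x = \<alpha> i] (mod \<eta>)" if "i \<in> {1..m}" for i
    using alpha_less that by (simp add: cong_def)
  ultimately show ?thesis using True by (auto simp: part_code_def code_gt_1 code_mod cong_def)
next
  case False
  then show ?thesis by (auto simp: part_code_def code_gt_1 dvd_code cong_0_iff)
qed

lemma valid_encode:
  assumes pos: "\<forall>x\<in>set \<pi>. 0 < part_size x"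
  shows "valid (encode \<pi>) \<longleftrightarrow> sorted_wrt above (map code \<pi>) \<and>
    (\<forall>i. i + width < length \<pi> \<longrightarrow>
        \<pi> ! i \<ge> shift \<eta> (\<pi> ! (i + width)) \<and>
        (\<not> overlined (\<pi> ! i) \<longrightarrow> \<pi> ! i > shift \<eta> (\<pi> ! (i + width)))) \<and>
     int (length (filter (\<lambda>x. x \<le> Part \<eta> False) \<pi>)) \<le> int r - 1"
proof -
  let ?c = "encode \<pi>" and ?n = "length \<pi>"
  have gt1: "1 < code x" if "x \<in> set \<pi>" for x using pos that code_gt_1 by auto
  have "sorted_wrt above tail"
    using period_pos
    by (auto simp: tail_def period_def sorted_wrt_append above_replicate, simp add: above_def)
  then have so: "sorted_wrt above ?c \<longleftrightarrow> sorted_wrt above (map code \<pi>)"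
  proof -
    have "above x y" if "x \<in> set (map code \<pi>)" "y \<in> set tail" for x y
    proof -
      have "1 < x" "y \<le> 0" using that gt1 P_mult by auto
      then show ?thesis by (simp add: above_def)
    qed
    then show ?thesis using \<open>sorted_wrt above tail\<close> unfolding encode_def sorted_wrt_append by blast
  qed
  have real: "\<not> above (?c ! (i + width) + period) (?c ! i) \<longleftrightarrow>
        \<pi> ! i \<ge> shift \<eta> (\<pi> ! (i + width)) \<and>
        (\<not> overlined (\<pi> ! i) \<longrightarrow> \<pi> ! i > shift \<eta> (\<pi> ! (i + width)))" if "i + width < ?n" for i
  proof -
    have e: "?c ! (i + width) + period = code (shift \<eta> (\<pi> ! (i + width)))" "?c ! i = code (\<pi> ! i)"
      using that by (simp_all add: encode_def nth_append code_shift_period)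
    show ?thesis unfolding e above_code by (auto simp: not_less order.order_iff_strict)
  qed
  \<comment> \<open>A phantom \<open>0\<close> forces the part \<open>w\<close> places above it
    beyond the non-overlined \<eta>, while \<open>- period\<close> forces nothing that a positive
    part could violate. With \<open>k - r\<close> zeros, exactly the last \<open>r - 1\<close> real
    parts escape the bound.\<close>
  have phantom: "\<not> above (?c ! (i + width) + period) (?c ! i) \<longleftrightarrow>
      (i + (r - 1) < ?n \<longrightarrow> period < code (\<pi> ! i))" if i: "?n \<le> i + width" "i < ?n" for i
  proof -
    have e: "?c ! i = code (\<pi> ! i)" "?c ! (i + width) = tail ! (i + width - ?n)"
      using i by (simp_all add: encode_def nth_append)
    have g: "1 < code (\<pi> ! i)" using gt1 i by simp
    show ?thesis
    proof (cases "i + (r - 1) < ?n")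
      case True
      then have "i + width - ?n < k - r" using i r_le_k r_pos k_eq by linarith
      then have "tail ! (i + width - ?n) = 0" by (simp add: tail_def nth_append)
      then show ?thesis using True H_even
        by (cases "code (\<pi> ! i) = period") (auto simp: e above_def not_less)
    next
      case False
      then have "k - r \<le> i + width - ?n" "i + width - ?n < k - r + (r - 1)"
        using i r_le_k r_pos k_eq by linarith+
      then have "tail ! (i + width - ?n) = - period" by (simp add: tail_def nth_append)
      then show ?thesis using False g by (simp add: e above_def)
    qed
  qed
  have small: "int (length (filter (\<lambda>x. x \<le> Part \<eta> False) \<pi>)) \<le> int r - 1 \<longleftrightarrow>
      (\<forall>i. i + (r - 1) < ?n \<longrightarrow> period < code (\<pi> ! i))" if s: "sorted_wrt above (map code \<pi>)"
  proof -
    have c: "period = code (Part \<eta> False)" by (simp add: code_def period_def)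
    have "length (filter (\<lambda>x. x \<le> Part \<eta> False) \<pi>) = length (filter (\<lambda>x. x \<le> period) (map code \<pi>))"
      by (simp add: filter_map o_def c)
    then show ?thesis
      using length_filter_le_sorted[OF s, of period "r - 1"] r_pos by auto
  qed
  have far: "(\<forall>i. i + width < length ?c \<longrightarrow> \<not> above (?c ! (i + width) + period) (?c ! i)) \<longleftrightarrow>
      (\<forall>i. i + width < ?n \<longrightarrow>
        \<pi> ! i \<ge> shift \<eta> (\<pi> ! (i + width)) \<and>
        (\<not> overlined (\<pi> ! i) \<longrightarrow> \<pi> ! i > shift \<eta> (\<pi> ! (i + width)))) \<and>
      (\<forall>i. i + (r - 1) < ?n \<longrightarrow> period < code (\<pi> ! i))"
    (is "?F \<longleftrightarrow> ?R \<and> ?S") if s: "sorted_wrt above (map code \<pi>)"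
  proof
    assume F: ?F
    have lc: "length ?c = ?n + width" using length_P by (simp add: encode_def)
    have ?R using F real lc by auto
    moreover have ?S
    proof (intro allI impI)
      fix i assume i: "i + (r - 1) < ?n"
      show "period < code (\<pi> ! i)"
      proof (cases "?n \<le> i + width")
        case True
        then show ?thesis using F phantom[of i] i lc by simp
      next
        case False
        \<comment> \<open>With a real part \<open>w\<close> places below, the bound already follows
          from the distance condition.\<close>
        let ?l = "i + width"
        have "\<pi> ! i \<ge> shift \<eta> (\<pi> ! ?l)" using \<open>?R\<close> False by simp
        then have "code (\<pi> ! ?l) + period \<le> code (\<pi> ! i)" by (simp flip: code_shift_period)
        moreover have "1 < code (\<pi> ! ?l)" using gt1 False by simp
        ultimately show ?thesis by simp
      qed
    qed
    ultimately show "?R \<and> ?S" by blast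
  next
    assume RS: "?R \<and> ?S"
    show ?F
    proof (intro allI impI)
      fix i assume "i + width < length ?c"
      then have "i < ?n" using length_P by (simp add: encode_def)
      then show "\<not> above (?c ! (i + width) + period) (?c ! i)"
        using real[of i] phantom[of i] RS by (cases "i + width < ?n") auto
    qed
  qed
  show ?thesis unfolding valid_def using so small far by blast
qed

text \<open>For \<open>j = 1\<close> condition (5) is a congruence modulo 1 and holds
  trivially.\<close>

lemma cong_mod_trivial: "[a = b] (mod (2 - int 1))"
  by (simp add: cong_def)

lemma config_encode: "config (encode \<pi>) \<longleftrightarrow> \<pi> \<in> B_bar 1 m \<alpha> \<eta> k r"
proof -
  have a: "(\<exists>a. encode \<pi> = a @ tail \<and> (\<forall>x\<in>set a. part_code x)) \<longleftrightarrow> (\<forall>x\<in>set \<pi>. part_code (code x))"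
    by (auto simp: encode_def)
  have "config (encode \<pi>) \<longleftrightarrow> (\<forall>x\<in>set \<pi>. part_code (code x)) \<and> valid (encode \<pi>)"
    unfolding config_def a by blast
  moreover have "(\<forall>x\<in>set \<pi>. part_code (code x)) \<Longrightarrow> \<forall>x\<in>set \<pi>. 0 < part_size x"
    using part_code_code by blast
  ultimately show ?thesis
    using valid_encode[of \<pi>] overpartition_code[of \<pi>]
    unfolding B_bar_def mem_Collect_eq part_code_code k_diff using cong_mod_trivial by blast
qed

lemma B_bar_0:
  "\<pi> \<in> B_bar 0 m \<alpha> \<eta> k r \<longleftrightarrow> \<pi> \<in> B_bar 1 m \<alpha> \<eta> k r \<and>
    (\<forall>i. i + (width - 1) < length \<pi> \<longrightarrow> (\<pi> ! i \<le> shift \<eta> (\<pi> ! (i + (width - 1))) \<and>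
        (overlined (\<pi> ! i) \<longrightarrow> \<pi> ! i < shift \<eta> (\<pi> ! (i + (width - 1)))) \<longrightarrow>
        [(\<Sum>h = i..i + (width - 1). int (part_size (\<pi> ! h) div \<eta>)) =
           int r - 1 + int (overlined_upto \<pi> (\<pi> ! i))] (mod 2)))"
proof -
  have mod2: "2 - int 0 = 2" by simp
  show ?thesis
    unfolding B_bar_def mem_Collect_eq k_diff mod2 using cong_mod_trivial by blast
qed

lemma parity_encode:
  assumes "sorted_wrt above (map code \<pi>)" and i: "i + (width - 1) < length \<pi>"
  shows "parity (drop i (encode \<pi>)) =
    (\<Sum>h = i..i + (width - 1). int (part_size (\<pi> ! h) div \<eta>)) - int (overlined_upto \<pi> (\<pi> ! i))"
proof -
  have "take width (drop i (encode \<pi>)) = map (\<lambda>h. code (\<pi> ! h)) [i..<i + width]"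
    using i by (intro nth_equalityI) (auto simp: encode_def nth_append)
  then have "(\<Sum>x\<leftarrow>take width (drop i (encode \<pi>)). x div period) =
      (\<Sum>h\<leftarrow>[i..<i + width]. int (part_size (\<pi> ! h) div \<eta>))"
    by (simp add: o_def code_div)
  also have "\<dots> = (\<Sum>h\<in>{i..<i + width}. int (part_size (\<pi> ! h) div \<eta>))"
    by (simp add: sum_list_distinct_conv_sum_set)
  also have "{i..<i + width} = {i..i + (width - 1)}" using width_pos by auto
  finally have s: "(\<Sum>x\<leftarrow>take width (drop i (encode \<pi>)). x div (period)) =
      (\<Sum>h = i..i + (width - 1). int (part_size (\<pi> ! h) div \<eta>))" .
  have "length (filter odd (drop i (encode \<pi>))) = overlined_upto \<pi> (\<pi> ! i)"
    using overlined_upto_nth[OF assms(1), of i] i by (simp add: encode_def filter_odd_tail)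
  then show ?thesis by (simp add: parity_def s)
qed

lemma wrong_encode:
  assumes "sorted_wrt above (map code \<pi>)" and i: "i + (width - 1) < length \<pi>"
  shows "wrong (drop i (encode \<pi>)) \<longleftrightarrow> \<not> (\<pi> ! i \<le> shift \<eta> (\<pi> ! (i + (width - 1))) \<and>
        (overlined (\<pi> ! i) \<longrightarrow> \<pi> ! i < shift \<eta> (\<pi> ! (i + (width - 1)))) \<longrightarrow>
        [(\<Sum>h = i..i + (width - 1). int (part_size (\<pi> ! h) div \<eta>)) =
           int r - 1 + int (overlined_upto \<pi> (\<pi> ! i))] (mod 2))"
proof -
  have e: "encode \<pi> ! (i + width - 1) + period = code (shift \<eta> (\<pi> ! (i + (width - 1))))"
    "encode \<pi> ! i = code (\<pi> ! i)" "i + width \<le> length (encode \<pi>)"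
    using i width_pos length_P by (auto simp: encode_def nth_append code_shift_period)
  have t: "tight (drop i (encode \<pi>)) \<longleftrightarrow> \<pi> ! i \<le> shift \<eta> (\<pi> ! (i + (width - 1))) \<and>
        (overlined (\<pi> ! i) \<longrightarrow> \<pi> ! i < shift \<eta> (\<pi> ! (i + (width - 1))))"
    unfolding tight_drop e above_code using e(3) by (auto simp: order.order_iff_strict)
  have "even (s - int v - (int r - 1)) \<longleftrightarrow> [s = int r - 1 + int v] (mod 2)" for s v
    by (simp add: cong_iff_dvd_diff algebra_simps)
  then show ?thesis unfolding wrong_def t parity_encode[OF assms] by blast
qed

lemma base_encode: "encode \<pi> \<in> base \<longleftrightarrow> \<pi> \<in> B 0 m \<alpha> \<eta> k r"
proof -
  have bar: "barred (encode \<pi>) \<longleftrightarrow> (\<exists>x\<in>set \<pi>. overlined x \<and> \<eta> dvd part_size x)"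
  proof -
    have "code x mod period = 1 \<longleftrightarrow> overlined x \<and> \<eta> dvd part_size x" for x
    proof (cases "overlined x")
      case False
      have "2 * int (part_size x mod \<eta>) \<noteq> 1" by (metis dvd_triv_left odd_one)
      then show ?thesis unfolding code_mod using False by simp
    qed (auto simp: code_mod dvd_eq_mod_eq_0)
    then show ?thesis using P_not_bar by (auto simp: barred_def encode_def)
  qed
  show ?thesis
  proof (cases "config (encode \<pi>) \<and> \<not> barred (encode \<pi>)")
    case True
    then have v: "valid (encode \<pi>)" "regular (encode \<pi>)"
      using config_regular by (auto simp: config_def)
    then have s: "sorted_wrt above (map code \<pi>)"
      by (simp add: valid_def encode_def sorted_wrt_append)
    \<comment> \<open>Condition (5) speaks of windows of real parts only, whereas
      \<open>base\<close> ranges over all places; wrong windows never reach the phantom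
      parts.\<close>
    have "(\<forall>i. \<not> wrong (drop i (encode \<pi>))) \<longleftrightarrow>
        (\<forall>i. i + (width - 1) < length \<pi> \<longrightarrow> \<not> wrong (drop i (encode \<pi>)))"
    proof -
      have "i + (width - 1) < length \<pi>" if "wrong (drop i (encode \<pi>))" for i
        using wrong_in_body[of "map code \<pi>" i] v that width_pos by (simp add: encode_def)
      then show ?thesis by blast
    qed
    then have "encode \<pi> \<in> base \<longleftrightarrow>
        (\<forall>i. i + (width - 1) < length \<pi> \<longrightarrow> \<not> wrong (drop i (encode \<pi>)))"
      using True by (simp add: base_def)
    also have "\<dots> \<longleftrightarrow> \<pi> \<in> B 0 m \<alpha> \<eta> k r"
      using True bar config_encode[of \<pi>] wrong_encode[OF s]
      unfolding B_def mem_Collect_eq B_bar_0 by blast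
    finally show ?thesis .
  next
    case False
    have "\<pi> \<in> B 0 m \<alpha> \<eta> k r \<Longrightarrow> \<pi> \<in> B_bar 1 m \<alpha> \<eta> k r"
      unfolding B_def mem_Collect_eq B_bar_0 by blast
    then show ?thesis using False bar config_encode by (auto simp: base_def B_def)
  qed
qed

lemma encode_surj: "config c \<Longrightarrow> \<exists>\<pi>. encode \<pi> = c"
proof -
  assume "config c"
  then obtain a where a: "c = a @ tail" "\<forall>x\<in>set a. part_code x" unfolding config_def by blast
  then have "\<forall>x\<in>set a. \<exists>y. code y = x" using code_surj by (auto simp: part_code_def)
  then have "\<exists>\<pi>. map code \<pi> = a"
    by (metis ex_map_conv)
  then show ?thesis using a(1) by (auto simp: encode_def)
qed

lemma bij_encode:
  "bij_betw encode (B_bar 1 m \<alpha> \<eta> k r) {c. config c}" "bij_betw encode (B 0 m \<alpha> \<eta> k r) base"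
proof -
  have "inj_on encode S" for S by (auto simp: inj_on_def encode_def)
  moreover have "encode ` B_bar 1 m \<alpha> \<eta> k r = {c. config c}" "encode ` B 0 m \<alpha> \<eta> k r = base"
    using config_encode base_encode encode_surj by (auto simp: image_iff base_def) metis+
  ultimately show "bij_betw encode (B_bar 1 m \<alpha> \<eta> k r) {c. config c}" "bij_betw encode (B 0 m \<alpha> \<eta> k r) base"
    by (simp_all add: bij_betw_def)
qed

lemma wt_encode: "wt (encode \<pi>) = int (weight \<pi>) + wt tail"
proof -
  have "(\<Sum>x\<leftarrow>map code \<pi>. x div 2) = int (weight \<pi>)"
    by (induction \<pi>) (simp_all add: weight_def code_div_2)
  then show ?thesis by (simp add: wt_def encode_def)
qed

section \<open>Distinct multiples of \<eta> and the composed bijection\<close>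

definition quotients :: "nat list \<Rightarrow> int list" where
  "quotients \<zeta> = map (\<lambda>z. int (z div \<eta>)) \<zeta>"

lemma bij_quotients:
  "bij_betw quotients (distinct_multiples \<eta>) {ds. sorted_wrt (>) ds \<and> (\<forall>d\<in>set ds. 0 < d)}"
proof (rule bij_betw_byWitness[where f' = "map (\<lambda>d. nat d * \<eta>)"])
  show "\<forall>\<zeta>\<in>distinct_multiples \<eta>. map (\<lambda>d. nat d * \<eta>) (quotients \<zeta>) = \<zeta>"
    by (auto simp: distinct_multiples_def quotients_def intro!: map_idI)
  show "\<forall>ds\<in>{ds. sorted_wrt (>) ds \<and> (\<forall>d\<in>set ds. 0 < d)}. quotients (map (\<lambda>d. nat d * \<eta>) ds) = ds"
    using eta_pos by (auto simp: quotients_def intro!: map_idI)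
  show "quotients ` distinct_multiples \<eta> \<subseteq> {ds. sorted_wrt (>) ds \<and> (\<forall>d\<in>set ds. 0 < d)}"
  proof (intro image_subsetI CollectI conjI)
    fix \<zeta> assume z: "\<zeta> \<in> distinct_multiples \<eta>"
    show "sorted_wrt (>) (quotients \<zeta>)" unfolding quotients_def sorted_wrt_map
    proof (rule sorted_wrt_mono_rel[of _ "(>)"])
      fix x y assume "x \<in> set \<zeta>" "y \<in> set \<zeta>" "x > y"
      moreover from this have "\<eta> dvd x" "\<eta> dvd y" using z by (auto simp: distinct_multiples_def)
      ultimately show "int (x div \<eta>) > int (y div \<eta>)"
        using div_less_mono eta_pos by (auto elim!: dvdE)
    qed (use z in \<open>simp add: distinct_multiples_def\<close>)
    show "\<forall>d\<in>set (quotients \<zeta>). 0 < d"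
      using z eta_pos by (auto simp: distinct_multiples_def quotients_def div_greater_zero_iff dest: dvd_imp_le)
  qed
  show "map (\<lambda>d. nat d * \<eta>) ` {ds. sorted_wrt (>) ds \<and> (\<forall>d\<in>set ds. 0 < d)} \<subseteq> distinct_multiples \<eta>"
  proof (intro image_subsetI)
    fix ds :: "int list" assume d: "ds \<in> {ds. sorted_wrt (>) ds \<and> (\<forall>d\<in>set ds. 0 < d)}"
    have "sorted_wrt (>) (map (\<lambda>d. nat d * \<eta>) ds)" unfolding sorted_wrt_map
      by (rule sorted_wrt_mono_rel[of _ "(>)"]) (use d eta_pos in auto)
    then show "map (\<lambda>d. nat d * \<eta>) ds \<in> distinct_multiples \<eta>"
      using d eta_pos by (auto simp: distinct_multiples_def)
  qed
qed

lemma sum_quotients: "\<zeta> \<in> distinct_multiples \<eta> \<Longrightarrow> sum_list (quotients \<zeta>) * int \<eta> = int (sum_list \<zeta>)"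
proof -
  have "\<forall>x\<in>set \<zeta>. \<eta> dvd x \<Longrightarrow> sum_list (quotients \<zeta>) * int \<eta> = int (sum_list \<zeta>)"
    by (induction \<zeta>) (auto simp: quotients_def algebra_simps simp flip: of_nat_mult)
  then show "\<zeta> \<in> distinct_multiples \<eta> \<Longrightarrow> sum_list (quotients \<zeta>) * int \<eta> = int (sum_list \<zeta>)"
    by (simp add: distinct_multiples_def)
qed

lemma bij_build:
  "bij_betw (\<lambda>(ds, c). build ds c) ({ds. sorted_wrt (>) ds \<and> (\<forall>d\<in>set ds. 0 < d)} \<times> base) {c. config c}"
  (is "bij_betw ?f (?D \<times> base) _")
  unfolding bij_betw_def
proof
  show "inj_on ?f (?D \<times> base)" using build_inject by (auto intro!: inj_onI)
  show "?f ` (?D \<times> base) = {c. config c}"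
  proof
    show "?f ` (?D \<times> base) \<subseteq> {c. config c}" using build(1) by auto
    show "{c. config c} \<subseteq> ?f ` (?D \<times> base)"
    proof
      fix c assume "c \<in> {c. config c}"
      then obtain ds e where "e \<in> base" "ds \<in> ?D" "c = ?f (ds, e)" using build_surj[of c] by auto
      then show "c \<in> ?f ` (?D \<times> base)" by blast
    qed
  qed
qed

lemma weighted_bijection:
  "\<exists>\<Phi>. bij_betw \<Phi> (distinct_multiples \<eta> \<times> B 0 m \<alpha> \<eta> k r) (B_bar 1 m \<alpha> \<eta> k r) \<and>
    (\<forall>\<zeta>\<in>distinct_multiples \<eta>. \<forall>\<mu>\<in>B 0 m \<alpha> \<eta> k r.
       weight (\<Phi> (\<zeta>, \<mu>)) = sum_list \<zeta> + weight \<mu>)"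
proof -
  let ?D = "{ds. sorted_wrt (>) ds \<and> (\<forall>d\<in>set ds. (0::int) < d)}"
  let ?S = "B_bar 1 m \<alpha> \<eta> k r"
  define \<Psi> where "\<Psi> = (\<lambda>(ds, c). build ds c) \<circ> map_prod quotients encode"
  define \<Phi> where "\<Phi> = inv_into ?S encode \<circ> \<Psi>"
  have "bij_betw (map_prod quotients encode) (distinct_multiples \<eta> \<times> B 0 m \<alpha> \<eta> k r) (?D \<times> base)"
    using bij_quotients bij_encode(2) unfolding bij_betw_def
    by (intro conjI map_prod_inj_on map_prod_surj_on; blast)
  then have \<Psi>: "bij_betw \<Psi> (distinct_multiples \<eta> \<times> B 0 m \<alpha> \<eta> k r) {c. config c}"
    unfolding \<Psi>_def using bij_build bij_betw_trans by blast
  then have "bij_betw \<Phi> (distinct_multiples \<eta> \<times> B 0 m \<alpha> \<eta> k r) ?S"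
    unfolding \<Phi>_def using bij_betw_inv_into[OF bij_encode(1)] bij_betw_trans by blast
  moreover have "weight (\<Phi> (\<zeta>, \<mu>)) = sum_list \<zeta> + weight \<mu>"
    if z: "\<zeta> \<in> distinct_multiples \<eta>" and u: "\<mu> \<in> B 0 m \<alpha> \<eta> k r" for \<zeta> \<mu>
  proof -
    have "\<Psi> (\<zeta>, \<mu>) \<in> {c. config c}" using \<Psi> z u by (auto simp: bij_betw_def)
    then have "encode (\<Phi> (\<zeta>, \<mu>)) = \<Psi> (\<zeta>, \<mu>)"
      unfolding \<Phi>_def using bij_betw_inv_into_right[OF bij_encode(1)] by simp
    moreover have "quotients \<zeta> \<in> ?D" using bij_quotients z by (auto simp: bij_betw_def)
    moreover have "encode \<mu> \<in> base" using u base_encode by simp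
    ultimately have "wt (encode (\<Phi> (\<zeta>, \<mu>))) = wt (encode \<mu>) + sum_list (quotients \<zeta>) * int \<eta>"
      using build(3)[of "encode \<mu>" "quotients \<zeta>"] by (simp add: \<Psi>_def period_def)
    then have "int (weight (\<Phi> (\<zeta>, \<mu>))) = int (weight \<mu>) + int (sum_list \<zeta>)"
      using sum_quotients[OF z] by (simp add: wt_encode)
    then show ?thesis by linarith
  qed
  ultimately show ?thesis by blast
qed

end

theorem theorem3p1:
  fixes m \<eta> k r :: nat and \<alpha> :: "nat \<Rightarrow> nat"
  assumes "0 < \<eta>"
    and "\<forall>i\<in>{1..m}. 0 < \<alpha> i \<and> \<alpha> i < \<eta>"
    and "strict_mono_on {1..m} \<alpha>"
    and "\<forall>i\<in>{1..m}. \<alpha> i = \<eta> - \<alpha> (m + 1 - i)"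
    and "k \<ge> r" and "r \<ge> m" and "k > m"
    and "\<not> (k = 1 \<and> r = 1)"
  shows "\<exists>\<Phi>. bij_betw \<Phi> (distinct_multiples \<eta> \<times> B 0 m \<alpha> \<eta> k r) (B_bar 1 m \<alpha> \<eta> k r) \<and>
    (\<forall>\<zeta>\<in>distinct_multiples \<eta>. \<forall>\<mu>\<in>B 0 m \<alpha> \<eta> k r.
       weight (\<Phi> (\<zeta>, \<mu>)) = sum_list \<zeta> + weight \<mu>)"
proof (cases "r = 0")
  case True
  \<comment> \<open>For \<open>r = 0\<close> the bound (4) asks for at most -1 small parts.\<close>
  then have "B_bar j m \<alpha> \<eta> k r = {}" for j by (auto simp: B_bar_def)
  then show ?thesis by (simp add: B_def bij_betw_def)
next
  case False
  \<comment> \<open>Here \<open>2 \<le> k\<close> rests on excluding \<open>k = r = 1\<close>. In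
    that case both sets of overpartitions contain only the empty one, while
    \<open>distinct_multiples \<eta>\<close> is infinite, so that no bijection exists.\<close>
  then interpret encoding m \<eta> k r \<alpha>
    using assms by unfold_locales auto
  show ?thesis by (rule weighted_bijection)
qed

end
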